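(* Let $\alpha_1,\alpha_2\in\mathbb{R}$, $0<q_1,q_2\le\infty$ and $0<p_1,p_2<\infty$. If $$\frac{d-1}{q_2}+(d+1)\alpha_2+\frac{2d}{p_1}<2\alpha_1+\frac{d}{p_2},$$ then there exists a sequence of functions $\{f^{(\nu)}\}_{\nu\ge0}$ such that $\|f^{(\nu)}\|_{\mathbf{F}^{\alpha_1,q_1}_{p_1}}\approx1$ (i.e. bounded above and below by positive constants independent of $\nu$), but $\|f^{(\nu)}\|_{\mathbf{F}^{\alpha_2,q_2}_{p_2}(AB)}\to0$ as $\nu\to\infty$.
   Context: Let $d\ge2$. Frequency vectors $\xi\in\hat{\mathbb{R}}^d$ are row vectors, and $\hat g(\xi)=\int_{\mathbb{R}^d}g(x)e^{-2\pi i\xi x}dx$. $\mathcal{S}$, $\mathcal{S}'$ are the Schwartz class and tempered distributions on $\mathbb{R}^d$. Classical (dyadic isotropic) inhomogeneous Triebel–Lizorkin space. Let $\varphi,\Phi\in\mathcal{S}$ with $\operatorname{supp}\hat\varphi\subseteq\{\frac12\le|\xi|\le2\}$, $\operatorname{supp}\hat\Phi\subseteq\{|\xi|\le2\}$, $|\hat\varphi(\xi)|\ge c>0$ for $\frac35\le|\xi|\le\frac53$, $|\hat\Phi(\xi)|\ge c>0$ for $|\xi|\le\frac53$; $\varphi_{2^\nu I}(x)=2^{d\nu}\varphi(2^\nu x)$. $\mathbf{F}^{\alpha,q}_p$ is the set of $f\in\mathcal{S}'$ with $\|f\|_{\mathbf{F}^{\alpha,q}_p}=\|\Phi*f\|_{L^p}+\big\|\big(\sum_{\nu=0}^\infty(2^{\nu\alpha}|\varphi_{2^\nu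 I}*f|)^q\big)^{1/q}\big\|_{L^p}<\infty$. Shearlets. Fix $\hat\psi_1,\hat\psi_2\in C^\infty(\mathbb{R})$ with $\operatorname{supp}\hat\psi_1\subset[-\frac12,-\frac1{16}]\cup[\frac1{16},\frac12]$, $\operatorname{supp}\hat\psi_2\subset[-1,1]$, $\sum_{j\ge0}|\hat\psi_1(2^{-2j}\omega)|^2=1$ for $|\omega|\ge\frac18$, and $|\hat\psi_2(\omega-1)|^2+|\hat\psi_2(\omega)|^2+|\hat\psi_2(\omega+1)|^2=1$ for $|\omega|\le1$. For $\mathfrak d=1,\dots,d$ let $\hat\psi^{(\mathfrak d)}(\xi)=\hat\psi_1(\xi_{\mathfrak d})\prod_{i\ne\mathfrak d}\hat\psi_2(\xi_i/\xi_{\mathfrak d})$. Let $A_{(\mathfrak d)}$ be the diagonal $d\times d$ matrix with entry $4$ in position $\mathfrak d$ and $2$ elsewhere. For $\ell\in\mathbb{Z}^{d-1}$ let $B^{[\ell]}_{(\mathfrak d)}$ be the identity matrix with the off-diagonal entries of row $\mathfrak d$ replaced, in order, by $\ell_1,\dots,\ell_{d-1}$; its inverse is $B^{[-\ell]}_{(\mathfrak d)}$. Write $|[\ell]|\preceq2^j$ if $|\ell_i|\le2^j$ for all $i$. For an invertible matrix $M$, $\psi_M(x)=|\det M|^{-1}\psi(M^{-1}x)$, and $\tilde\psi(x)=\overline{\psi(-x)}$. Let $\hat\Psi\in C_c^\infty(\hat{\mathbb{R}}^d)$ with $\operatorname{supp}\hat\Psi\subset[-\frac14,\frac14]^d$ and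 $|\hat\Psi|=1$ on $\mathcal R=[-\frac18,\frac18]^d$ be such that for all $\xi$ $$|\hat\Psi(\xi)|^2\chi_{\mathcal R}(\xi)+\sum_{\mathfrak d=1}^d\sum_{j\ge0}\sum_{|[\ell]|\preceq2^j}|\hat\psi^{(\mathfrak d)}(\xi A^{-j}_{(\mathfrak d)}B^{[-\ell]}_{(\mathfrak d)})|^2\chi_{\mathcal D^{(\mathfrak d)}}(\xi)=1,$$ where $\mathcal D^{(\mathfrak d)}=\{\xi:|\xi_{\mathfrak d}|\ge\frac18,\ |\xi_i/\xi_{\mathfrak d}|\le1\ (i\ne\mathfrak d)\}$. Put $|Q_j|=2^{-(d+1)j}$. Shear anisotropic inhomogeneous Triebel–Lizorkin space. $\mathbf{F}^{\alpha,q}_p(AB)$ is the set of $f\in\mathcal{S}'$ with $$\|f\|_{\mathbf{F}^{\alpha,q}_p(AB)}=\|f*\Psi\|_{L^p}+\Big\|\Big(\sum_{\mathfrak d=1}^d\sum_{j\ge0}\sum_{|[\ell]|\preceq2^j}\big[|Q_j|^{-\alpha}|\tilde\psi^{(\mathfrak d)}_{A^{-j}_{(\mathfrak d)}B^{[-\ell]}_{(\mathfrak d)}}*f|\big]^q\Big)^{1/q}\Big\|_{L^p}<\infty$$ (supremum when $q=\infty$).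
   Formalization: The identity assumed of the shearlet system is required for almost every ξ instead of all ξ: on the shared boundaries of the closed cones (e.g. ξ=(t,…,t), t>1/8) every cone contributes 1, so the sum is d≥2 and the pointwise identity can never hold. *)

theory Defs
  imports "HOL-Analysis.Analysis"
begin

text \<open>Throughout, the ambient space is \<open>real^'d\<close> with \<open>d = CARD('d)\<close>.\<close>

section \<open>Schwartz functions, tempered distributions, Fourier transform\<close>

primrec iter_pderiv :: "'a list \<Rightarrow> ('a::euclidean_space \<Rightarrow> complex) \<Rightarrow> 'a \<Rightarrow> complex" where
  "iter_pderiv [] f = f"
| "iter_pderiv (b # bs) f = (\<lambda>x. frechet_derivative (iter_pderiv bs f) (at x) b)"

definition smooth :: "('a::euclidean_space \<Rightarrow> complex) \<Rightarrow> bool" where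
  "smooth f \<longleftrightarrow> (\<forall>bs. set bs \<subseteq> Basis \<longrightarrow> iter_pderiv bs f differentiable_on UNIV)"

definition schwartz :: "('a::euclidean_space \<Rightarrow> complex) set" where
  "schwartz = {f. smooth f \<and>
     (\<forall>(k::nat) bs. set bs \<subseteq> Basis \<longrightarrow>
        bounded (range (\<lambda>x. (1 + norm x) ^ k * norm (iter_pderiv bs f x))))}"

definition schwartz_seminorm ::
    "nat \<Rightarrow> 'a list \<Rightarrow> ('a::euclidean_space \<Rightarrow> complex) \<Rightarrow> real" where
  "schwartz_seminorm k bs f = (SUP x. (1 + norm x) ^ k * norm (iter_pderiv bs f x))"

text \<open>The Schwartz space is metrizable, so continuity of a linear functional is sequential
  continuity at 0. A functional is a total HOL function; only its values on \<open>schwartz\<close> matter.\<close>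

definition tempered_distribution ::
    "(('a::euclidean_space \<Rightarrow> complex) \<Rightarrow> complex) \<Rightarrow> bool" where
  "tempered_distribution u \<longleftrightarrow>
     (\<forall>g\<in>schwartz. \<forall>h\<in>schwartz. \<forall>a b. u (\<lambda>x. a * g x + b * h x) = a * u g + b * u h) \<and>
     (\<forall>g::nat \<Rightarrow> 'a \<Rightarrow> complex.
        (\<forall>n. g n \<in> schwartz) \<and>
        (\<forall>k bs. set bs \<subseteq> Basis \<longrightarrow> (\<lambda>n. schwartz_seminorm k bs (g n)) \<longlonglongrightarrow> 0)
        \<longrightarrow> (\<lambda>n. u (g n)) \<longlonglongrightarrow> 0)"

definition distr_of ::
    "('a::euclidean_space \<Rightarrow> complex) \<Rightarrow> ('a \<Rightarrow> complex) \<Rightarrow> complex" where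
  "distr_of f g = (LINT x|lborel. f x * g x)"

definition tempered_function :: "('a::euclidean_space \<Rightarrow> complex) \<Rightarrow> bool" where
  "tempered_function f \<longleftrightarrow>
     f \<in> borel_measurable borel \<and>
     (\<forall>g\<in>schwartz. integrable lborel (\<lambda>x. f x * g x)) \<and>
     tempered_distribution (distr_of f)"

definition conv ::
    "('a::euclidean_space \<Rightarrow> complex) \<Rightarrow> (('a \<Rightarrow> complex) \<Rightarrow> complex) \<Rightarrow> 'a \<Rightarrow> complex" where
  "conv g u x = u (\<lambda>y. g (x - y))"

definition fourier :: "('a::euclidean_space \<Rightarrow> complex) \<Rightarrow> 'a \<Rightarrow> complex" where
  "fourier g \<xi> = (LINT x|lborel. g x * exp (- (2 * of_real pi * \<i> * of_real (\<xi> \<bullet> x))))"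

definition supp :: "('a::topological_space \<Rightarrow> complex) \<Rightarrow> 'a set" where
  "supp f = closure {x. f x \<noteq> 0}"


section \<open>Mixed quasi-norms\<close>

definition enn_powr :: "ennreal \<Rightarrow> real \<Rightarrow> ennreal" where
  "enn_powr x r = (if x = \<infinity> then \<infinity> else ennreal (enn2real x powr r))"
    \<comment> \<open>only used for \<open>r > 0\<close>\<close>

definition Lp_norm :: "real \<Rightarrow> ('a::euclidean_space \<Rightarrow> ennreal) \<Rightarrow> ennreal" where
  "Lp_norm p G = enn_powr (\<integral>\<^sup>+ x. enn_powr (G x) p \<partial>lborel) (1 / p)"

definition lq_norm :: "ennreal \<Rightarrow> 'i set \<Rightarrow> ('i \<Rightarrow> ennreal) \<Rightarrow> ennreal" where
  "lq_norm q I a =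
     (if q = \<infinity> then (SUP i\<in>I. a i)
      else enn_powr (\<Sum>\<^sub>\<infinity>i\<in>I. enn_powr (a i) (enn2real q)) (1 / enn2real q))"


section \<open>Classical inhomogeneous Triebel--Lizorkin spaces\<close>

definition dyadic_generators ::
    "(real^'d \<Rightarrow> complex) \<Rightarrow> (real^'d \<Rightarrow> complex) \<Rightarrow> bool" where
  "dyadic_generators \<phi> \<Phi> \<longleftrightarrow>
     \<phi> \<in> schwartz \<and> \<Phi> \<in> schwartz \<and>
     supp (fourier \<phi>) \<subseteq> {\<xi>. 1/2 \<le> norm \<xi> \<and> norm \<xi> \<le> 2} \<and>
     supp (fourier \<Phi>) \<subseteq> {\<xi>. norm \<xi> \<le> 2} \<and>
     (\<exists>c>0. (\<forall>\<xi>. 3/5 \<le> norm \<xi> \<and> norm \<xi> \<le> 5/3 \<longrightarrow> c \<le> norm (fourier \<phi> \<xi>)) \<and>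
            (\<forall>\<xi>. norm \<xi> \<le> 5/3 \<longrightarrow> c \<le> norm (fourier \<Phi> \<xi>)))"

definition dyadic_dilate :: "nat \<Rightarrow> (real^'d \<Rightarrow> complex) \<Rightarrow> real^'d \<Rightarrow> complex" where
  "dyadic_dilate \<nu> g x = of_real (2 ^ (CARD('d) * \<nu>)) * g ((2 ^ \<nu>) *\<^sub>R x)"

definition F_norm ::
    "(real^'d \<Rightarrow> complex) \<Rightarrow> (real^'d \<Rightarrow> complex) \<Rightarrow> real \<Rightarrow> ennreal \<Rightarrow> real
      \<Rightarrow> ((real^'d \<Rightarrow> complex) \<Rightarrow> complex) \<Rightarrow> ennreal" where
  "F_norm \<phi> \<Phi> \<alpha> q p u =
     Lp_norm p (\<lambda>x. ennreal (norm (conv \<Phi> u x))) +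
     Lp_norm p (\<lambda>x. lq_norm q (UNIV::nat set)
        (\<lambda>\<nu>. ennreal (2 powr (real \<nu> * \<alpha>) * norm (conv (dyadic_dilate \<nu> \<phi>) u x))))"

definition F_space ::
    "(real^'d \<Rightarrow> complex) \<Rightarrow> (real^'d \<Rightarrow> complex) \<Rightarrow> real \<Rightarrow> ennreal \<Rightarrow> real
      \<Rightarrow> ((real^'d \<Rightarrow> complex) \<Rightarrow> complex) set" where
  "F_space \<phi> \<Phi> \<alpha> q p = {u. tempered_distribution u \<and> F_norm \<phi> \<Phi> \<alpha> q p u < \<infinity>}"


section \<open>Shearlets\<close>

primrec mat_pow :: "real^'d^'d \<Rightarrow> nat \<Rightarrow> real^'d^'d" where
  "mat_pow M 0 = mat 1"
| "mat_pow M (Suc n) = M ** mat_pow M n"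

definition A_mat :: "'d \<Rightarrow> real^'d^'d" where
  "A_mat \<dd> = (\<chi> i k. if i = k then (if i = \<dd> then 4 else 2) else 0)"

text \<open>A shear parameter in \<open>\<int>\<^sup>d\<^sup>-\<^sup>1\<close> is encoded as an integer family \<open>l\<close> indexed by all coordinates with
  \<open>l \<dd> = 0\<close>: the entry placed in column \<open>k\<close> of row \<open>\<dd>\<close> is \<open>l k\<close>, for \<open>k \<noteq> \<dd>\<close>.\<close>

definition B_mat :: "'d \<Rightarrow> ('d \<Rightarrow> int) \<Rightarrow> real^'d^'d" where
  "B_mat \<dd> l = (\<chi> i k. if i = k then 1 else if i = \<dd> then of_int (l k) else 0)"

definition AB_mat :: "'d \<Rightarrow> nat \<Rightarrow> ('d \<Rightarrow> int) \<Rightarrow> real^'d^'d" where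
  "AB_mat \<dd> j l = mat_pow (matrix_inv (A_mat \<dd>)) j ** B_mat \<dd> (\<lambda>k. - l k)"
    \<comment> \<open>\<open>A\<^sup>-\<^sup>j B\<^sup>[\<^sup>-\<^sup>l\<^sup>]\<close>\<close>

definition shears :: "'d \<Rightarrow> nat \<Rightarrow> ('d \<Rightarrow> int) set" where
  "shears \<dd> j = {l. l \<dd> = 0 \<and> (\<forall>i. \<bar>l i\<bar> \<le> 2 ^ j)}"

definition shear_index :: "('d \<times> nat \<times> ('d \<Rightarrow> int)) set" where
  "shear_index = {(\<dd>, j, l). l \<in> shears \<dd> j}"

definition mat_dilate :: "real^'d^'d \<Rightarrow> (real^'d \<Rightarrow> complex) \<Rightarrow> real^'d \<Rightarrow> complex" where
  "mat_dilate M g x = of_real (inverse \<bar>det M\<bar>) * g (matrix_inv M *v x)"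

definition tilde :: "(real^'d \<Rightarrow> complex) \<Rightarrow> real^'d \<Rightarrow> complex" where
  "tilde g x = cnj (g (- x))"

definition psi_hat ::
    "(real \<Rightarrow> complex) \<Rightarrow> (real \<Rightarrow> complex) \<Rightarrow> 'd::finite \<Rightarrow> real^'d \<Rightarrow> complex" where
  "psi_hat \<psi>1h \<psi>2h \<dd> \<xi> = \<psi>1h (\<xi> $ \<dd>) * (\<Prod>i\<in>UNIV - {\<dd>}. \<psi>2h (\<xi> $ i / \<xi> $ \<dd>))"
    \<comment> \<open>at \<open>\<xi> $ \<dd> = 0\<close> this is 0, as it should be, because \<open>\<psi>1h 0 = 0\<close>\<close>

definition low_box :: "(real^'d) set" where
  "low_box = {\<xi>. \<forall>i. \<bar>\<xi> $ i\<bar> \<le> 1/8}"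

definition cone :: "'d \<Rightarrow> (real^'d) set" where
  "cone \<dd> = {\<xi>. 1/8 \<le> \<bar>\<xi> $ \<dd>\<bar> \<and> (\<forall>i. i \<noteq> \<dd> \<longrightarrow> \<bar>\<xi> $ i / \<xi> $ \<dd>\<bar> \<le> 1)}"

text \<open>\<open>\<psi>1h\<close> and \<open>\<psi>2h\<close> are the one-dimensional functions on the frequency side; \<open>\<psi> \<dd>\<close> is the
  Schwartz function whose Fourier transform is \<open>psi_hat \<psi>1h \<psi>2h \<dd>\<close> (a smooth function of compact
  support). Frequency vectors are row vectors, so matrices act on them by \<open>v*\<close>.

  The tiling identity is required almost everywhere only: the closed sets \<open>low_box\<close> and \<open>cone \<dd>\<close>
  share boundary points, where the left-hand side is at least 2, so that the identity cannot hold
  at every point. These overlaps are null sets.\<close>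

definition shearlet_generators ::
    "(real \<Rightarrow> complex) \<Rightarrow> (real \<Rightarrow> complex) \<Rightarrow> ('d \<Rightarrow> real^'d \<Rightarrow> complex)
      \<Rightarrow> (real^'d \<Rightarrow> complex) \<Rightarrow> bool" where
  "shearlet_generators \<psi>1h \<psi>2h \<psi> \<Psi> \<longleftrightarrow>
     smooth \<psi>1h \<and> smooth \<psi>2h \<and>
     supp \<psi>1h \<subseteq> {-1/2..-1/16} \<union> {1/16..1/2} \<and>
     supp \<psi>2h \<subseteq> {-1..1} \<and>
     (\<forall>\<omega>. \<bar>\<omega>\<bar> \<ge> 1/8 \<longrightarrow> (\<lambda>j. (norm (\<psi>1h (\<omega> / 2 ^ (2 * j))))\<^sup>2) sums 1) \<and>
     (\<forall>\<omega>. \<bar>\<omega>\<bar> \<le> 1 \<longrightarrow>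
        (norm (\<psi>2h (\<omega> - 1)))\<^sup>2 + (norm (\<psi>2h \<omega>))\<^sup>2 + (norm (\<psi>2h (\<omega> + 1)))\<^sup>2 = 1) \<and>
     (\<forall>\<dd>. \<psi> \<dd> \<in> schwartz \<and> fourier (\<psi> \<dd>) = psi_hat \<psi>1h \<psi>2h \<dd>) \<and>
     \<Psi> \<in> schwartz \<and> smooth (fourier \<Psi>) \<and>
     supp (fourier \<Psi>) \<subseteq> {\<xi>. \<forall>i. \<bar>\<xi> $ i\<bar> \<le> 1/4} \<and>
     (\<forall>\<xi>\<in>low_box. norm (fourier \<Psi> \<xi>) = 1) \<and>
     (AE \<xi> in lborel.
        ((\<lambda>(\<dd>, j, l). (norm (fourier (\<psi> \<dd>) (\<xi> v* AB_mat \<dd> j l)))\<^sup>2 * indicator (cone \<dd>) \<xi>)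
          has_sum (1 - (norm (fourier \<Psi> \<xi>))\<^sup>2 * indicator low_box \<xi>)) shear_index)"


section \<open>Shear anisotropic inhomogeneous Triebel--Lizorkin spaces\<close>

definition Q_vol :: "'d::finite itself \<Rightarrow> nat \<Rightarrow> real" where
  "Q_vol _ j = 2 powr (- (real (CARD('d) + 1) * real j))"

definition FAB_norm ::
    "('d \<Rightarrow> real^'d \<Rightarrow> complex) \<Rightarrow> (real^'d \<Rightarrow> complex) \<Rightarrow> real \<Rightarrow> ennreal \<Rightarrow> real
      \<Rightarrow> ((real^'d \<Rightarrow> complex) \<Rightarrow> complex) \<Rightarrow> ennreal" where
  "FAB_norm \<psi> \<Psi> \<alpha> q p u =
     Lp_norm p (\<lambda>x. ennreal (norm (conv \<Psi> u x))) +
     Lp_norm p (\<lambda>x. lq_norm q shear_index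
        (\<lambda>(\<dd>, j, l). ennreal (Q_vol TYPE('d) j powr (- \<alpha>) *
            norm (conv (mat_dilate (AB_mat \<dd> j l) (tilde (\<psi> \<dd>))) u x))))"

definition FAB_space ::
    "('d \<Rightarrow> real^'d \<Rightarrow> complex) \<Rightarrow> (real^'d \<Rightarrow> complex) \<Rightarrow> real \<Rightarrow> ennreal \<Rightarrow> real
      \<Rightarrow> ((real^'d \<Rightarrow> complex) \<Rightarrow> complex) set" where
  "FAB_space \<psi> \<Psi> \<alpha> q p = {u. tempered_distribution u \<and> FAB_norm \<psi> \<Psi> \<alpha> q p u < \<infinity>}"

end

theory Submission
  imports Defs "HOL-Probability.Probability"
begin

text \<open>
  The functions are \<open>f\<^sub>n(y) = 2\<^bsup>2n(d/p\<^sub>1 - \<alpha>\<^sub>1)\<^esup> (tilde \<phi>)(4\<^sup>n y)\<close>, whose frequencies lie in the annulus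
  \<open>4\<^sup>n/2 \<le> |\<xi>| \<le> 2 4\<^sup>n\<close>. At most five dyadic bands meet this annulus, and on each of them \<open>f\<^sub>n\<close> keeps its
  concentration at scale \<open>4\<^sup>-\<^sup>n\<close>; hence the classical norm is comparable to 1, the lower bound coming from
  \<open>\<phi> * tilde \<phi>(0) = \<parallel>\<phi>\<parallel>\<^sub>2\<^sup>2 > 0\<close>. A shearlet at scale \<open>j\<close> interacts with \<open>f\<^sub>n\<close> only if \<open>j = n + O(1)\<close>,
  which leaves \<open>O(2\<^bsup>n(d-1)\<^esup>)\<close> terms, and the corresponding convolutions are bounded by the amplitude of
  \<open>f\<^sub>n\<close> and decay rapidly at scale \<open>2\<^sup>-\<^sup>n\<close>. Thus the shear anisotropic norm is at most a constant times
  \<open>2\<^bsup>n\<epsilon>\<^esup>\<close>, where \<open>\<epsilon>\<close> is the difference of the two sides of the hypothesis and is negative.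
\<close>

section \<open>Linear changes of variables\<close>

text \<open>The hypothesis is a count of exponents of 2^n. The amplitude that normalises the
  classical norm contributes 2d/p1 - 2 \<alpha>1; the weight |Q_n|^(-\<alpha>2) contributes (d+1)
  \<alpha>2; about 2^(n(d-1)) shears, all charged alike, contribute (d-1)/q2; and the L^p2 norm of a
  bump of width 2^-n contributes -d/p2. The dilation is by 4^n because the matrices expand by 4 in
  one direction, so that dyadic band 2n and shearlet scale n occupy comparable shells of
  frequencies. Every shearlet of scale n is concentrated, up to constants, in a ball of radius 2^-n
  whatever its shear, and this crude information is enough: the shearlet terms are estimated through
  absolute values, and oscillation enters only through disjoint frequency supports. Disjointness has
  to give exact vanishing at every point, because the norms run over infinitely many indices; it is
  drawn from injectivity of the Fourier transform on continuous bounded integrable functions, so no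
  inversion formula enters.\<close>

definition volume_scaling :: "('a::euclidean_space \<Rightarrow> 'a) \<Rightarrow> real \<Rightarrow> bool" where
  "volume_scaling T c \<longleftrightarrow>
     T \<in> borel_measurable borel \<and> 0 < c \<and> lborel = density (distr lborel borel T) (\<lambda>_. ennreal c)"

lemma volume_scaling_measurable [measurable_dest]:
  "volume_scaling T c \<Longrightarrow> T \<in> borel_measurable borel"
  by (simp add: volume_scaling_def)

lemma volume_scaling_pos: "volume_scaling T c \<Longrightarrow> 0 < c"
  by (simp add: volume_scaling_def)

text \<open>The constant \<open>c\<close> is the Jacobian |det T|. Encoding the substitution as one
  identity of measures makes the rules for nonnegative integrals, integrability and Bochner
  integrals formal consequences, and it covers affine maps such as
  \<open>\<lambda>y. T (x - y)\<close>.\<close>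

lemma volume_scaling_nn_integral:
  assumes T: "volume_scaling T c" and [measurable]: "f \<in> borel_measurable borel"
  shows "(\<integral>\<^sup>+x. f x \<partial>lborel) = ennreal c * (\<integral>\<^sup>+x. f (T x) \<partial>lborel)"
proof -
  have [measurable]: "T \<in> borel_measurable borel" using T by (rule volume_scaling_measurable)
  have "(\<integral>\<^sup>+x. f x \<partial>lborel) = (\<integral>\<^sup>+x. f x \<partial>density (distr lborel borel T) (\<lambda>_. ennreal c))"
    using T unfolding volume_scaling_def by metis
  then show ?thesis
    by (simp add: nn_integral_density nn_integral_distr nn_integral_cmult)
qed

lemma volume_scalingI:
  assumes [measurable]: "T \<in> borel_measurable borel" and c: "0 < c"
    and eq: "\<And>f. f \<in> borel_measurable borel \<Longrightarrow>
               (\<integral>\<^sup>+x. f x \<partial>lborel) = ennreal c * (\<integral>\<^sup>+x. f (T x) \<partial>lborel)"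
  shows "volume_scaling T c"
  unfolding volume_scaling_def
proof (intro conjI assms)
  show "lborel = density (distr lborel borel T) (\<lambda>_. ennreal c)"
  proof (rule measure_eqI)
    fix A :: "'a set" assume "A \<in> sets lborel"
    then have [measurable]: "A \<in> sets borel" by simp
    have "emeasure lborel A = (\<integral>\<^sup>+x. indicator A x \<partial>lborel)" by simp
    also have "\<dots> = ennreal c * (\<integral>\<^sup>+x. indicator A (T x) \<partial>lborel)" by (rule eq) simp
    also have "\<dots> = emeasure (density (distr lborel borel T) (\<lambda>_. ennreal c)) A"
      by (simp add: emeasure_density nn_integral_distr nn_integral_cmult del: nn_integral_indicator)
    finally show "emeasure lborel A = emeasure (density (distr lborel borel T) (\<lambda>_. ennreal c)) A" .
  qed simp
qed

lemma volume_scaling_integrable_iff: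
  fixes f :: "'a::euclidean_space \<Rightarrow> 'b::{banach, second_countable_topology}"
  assumes T: "volume_scaling T c" and [measurable]: "f \<in> borel_measurable borel"
  shows "integrable lborel (\<lambda>x. f (T x)) \<longleftrightarrow> integrable lborel f"
proof -
  have [measurable]: "T \<in> borel_measurable borel" using T by (rule volume_scaling_measurable)
  have "(\<integral>\<^sup>+x. ennreal (norm (f x)) \<partial>lborel) = ennreal c * (\<integral>\<^sup>+x. ennreal (norm (f (T x))) \<partial>lborel)"
    using volume_scaling_nn_integral[OF T, of "\<lambda>x. ennreal (norm (f x))"] by simp
  then show ?thesis using volume_scaling_pos[OF T]
    unfolding integrable_iff_bounded
    by (auto simp: ennreal_mult_less_top ennreal_mult_eq_top_iff less_top[symmetric])
qed

lemma volume_scaling_integral: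
  fixes f :: "'a::euclidean_space \<Rightarrow> 'b::{banach, second_countable_topology}"
  assumes T: "volume_scaling T c" and [measurable]: "f \<in> borel_measurable borel"
  shows "(\<integral>x. f x \<partial>lborel) = c *\<^sub>R (\<integral>x. f (T x) \<partial>lborel)"
proof -
  have [measurable]: "T \<in> borel_measurable borel" using T by (rule volume_scaling_measurable)
  have c: "0 < c" using T by (rule volume_scaling_pos)
  have "(\<integral>x. f x \<partial>lborel) = (\<integral>x. f x \<partial>density (distr lborel borel T) (\<lambda>_. ennreal c))"
    using T unfolding volume_scaling_def by metis
  then show ?thesis using c
    by (simp add: integral_density integral_distr)
qed

lemma volume_scaling_compose:
  assumes S: "volume_scaling S a" and T: "volume_scaling T b"
  shows "volume_scaling (\<lambda>x. S (T x)) (a * b)"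
proof (rule volume_scalingI)
  note [measurable] = S[THEN volume_scaling_measurable] T[THEN volume_scaling_measurable]
  show "(\<lambda>x. S (T x)) \<in> borel_measurable borel" by measurable
  show "0 < a * b" using S T by (simp add: volume_scaling_pos)
  fix f :: "'a \<Rightarrow> ennreal" assume [measurable]: "f \<in> borel_measurable borel"
  show "(\<integral>\<^sup>+x. f x \<partial>lborel) = ennreal (a * b) * (\<integral>\<^sup>+x. f (S (T x)) \<partial>lborel)"
    using volume_scaling_nn_integral[OF S, of f] volume_scaling_nn_integral[OF T, of "\<lambda>x. f (S x)"]
      volume_scaling_pos[OF S] volume_scaling_pos[OF T]
    by (simp add: ennreal_mult mult.assoc)
qed

lemma volume_scaling_affine:
  fixes t :: "'a::euclidean_space"
  assumes "c \<noteq> 0"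
  shows "volume_scaling (\<lambda>x. t + c *\<^sub>R x) (\<bar>c\<bar> ^ DIM('a))"
  unfolding volume_scaling_def using lborel_affine[OF assms, of t] assms by simp

lemma volume_scaling_diff: "volume_scaling (\<lambda>y. x - y) 1" for x :: "'a::euclidean_space"
  using volume_scaling_affine[of "-1" x] by simp

lemma volume_scaling_scaleR:
  "r > 0 \<Longrightarrow> volume_scaling (\<lambda>x::'a::euclidean_space. r *\<^sub>R x) (r ^ DIM('a))"
  using volume_scaling_affine[of r "0::'a"] by simp

lemma volume_scaling_diagonal:
  fixes c :: "'a::euclidean_space \<Rightarrow> real"
  assumes "\<And>b. b \<in> Basis \<Longrightarrow> 0 < c b"
  shows "volume_scaling (\<lambda>x. \<Sum>b\<in>Basis. (c b * (x \<bullet> b)) *\<^sub>R b) (\<Prod>b\<in>Basis. c b)"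
proof -
  have "lborel = density (distr lborel borel (\<lambda>x. 0 + (\<Sum>j\<in>Basis. (c j * (x \<bullet> j)) *\<^sub>R j)))
          (\<lambda>_. (\<Prod>j\<in>Basis. \<bar>c j\<bar>))"
    by (rule lborel_affine_euclidean) (use assms in fastforce)
  moreover have "(\<Prod>j\<in>Basis. \<bar>c j\<bar>) = (\<Prod>j\<in>Basis. c j)"
    using assms by (intro prod.cong) (auto simp: less_imp_le)
  ultimately show ?thesis
    unfolding volume_scaling_def using assms by (simp add: prod_pos)
qed

text \<open>Fubini with the \<open>e\<close>-coordinate innermost: on each line parallel to
  \<open>e\<close> the map is a translation, because \<open>w\<close> is constant there, and
  translations preserve Lebesgue measure.\<close>

lemma volume_scaling_shear:
  fixes e :: "'a::euclidean_space"
  assumes e: "e \<in> Basis" and [measurable]: "w \<in> borel_measurable borel"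
    and w: "\<And>x t. w (x + t *\<^sub>R e) = w x"
  shows "volume_scaling (\<lambda>x. x + w x *\<^sub>R e) 1"
proof (rule volume_scalingI)
  show "(\<lambda>x. x + w x *\<^sub>R e) \<in> borel_measurable borel" by measurable
  fix f :: "'a \<Rightarrow> ennreal" assume [measurable]: "f \<in> borel_measurable borel"
  interpret product_sigma_finite "\<lambda>_::'a. lborel :: real measure" by standard
  define I where "I = Basis - {e}"
  have I: "finite I" "e \<notin> I" "insert e I = (Basis::'a set)" using e by (auto simp: I_def)
  define P where "P = (\<lambda>x::'a \<Rightarrow> real. \<Sum>b\<in>I. x b *\<^sub>R b)"
  have upd: "(\<Sum>b\<in>Basis. (x(e := t)) b *\<^sub>R b) = P x + t *\<^sub>R e" for x t
  proof -
    have "(\<Sum>b\<in>Basis. (x(e := t)) b *\<^sub>R b) = t *\<^sub>R e + (\<Sum>b\<in>I. (x(e := t)) b *\<^sub>R b)"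
      using I by (subst I(3)[symmetric], subst sum.insert) auto
    also have "(\<Sum>b\<in>I. (x(e := t)) b *\<^sub>R b) = P x"
      unfolding P_def using I by (intro sum.cong) auto
    finally show ?thesis by (simp add: add.commute)
  qed
  have int: "(\<integral>\<^sup>+x. g x \<partial>lborel) = (\<integral>\<^sup>+x. (\<integral>\<^sup>+t. g (P x + t *\<^sub>R e) \<partial>lborel) \<partial>(\<Pi>\<^sub>M b\<in>I. lborel))"
    if [measurable]: "g \<in> borel_measurable borel" for g :: "'a \<Rightarrow> ennreal"
  proof -
    have "(\<integral>\<^sup>+x. g x \<partial>lborel) = (\<integral>\<^sup>+x. g (\<Sum>b\<in>Basis. x b *\<^sub>R b) \<partial>(\<Pi>\<^sub>M b\<in>(Basis::'a set). lborel))"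
      by (subst lborel_eq) (simp add: nn_integral_distr)
    also have "\<dots> = (\<integral>\<^sup>+x. g (\<Sum>b\<in>Basis. x b *\<^sub>R b) \<partial>(\<Pi>\<^sub>M b\<in>insert e I. lborel))"
      by (simp only: I(3))
    also have "\<dots> = (\<integral>\<^sup>+x. (\<integral>\<^sup>+t. g (\<Sum>b\<in>Basis. (x(e := t)) b *\<^sub>R b) \<partial>lborel) \<partial>(\<Pi>\<^sub>M b\<in>I. lborel))"
      by (subst product_nn_integral_insert[OF I(1,2)]) (simp_all add: I(3))
    finally show ?thesis by (simp only: upd)
  qed
  have "(\<integral>\<^sup>+x. f (x + w x *\<^sub>R e) \<partial>lborel)
      = (\<integral>\<^sup>+x. (\<integral>\<^sup>+t. f (P x + t *\<^sub>R e + w (P x) *\<^sub>R e) \<partial>lborel) \<partial>(\<Pi>\<^sub>M b\<in>I. lborel))"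
    by (subst int) (simp_all add: w)
  also have "\<dots> = (\<integral>\<^sup>+x. (\<integral>\<^sup>+t. f (P x + (w (P x) + 1 * t) *\<^sub>R e) \<partial>lborel) \<partial>(\<Pi>\<^sub>M b\<in>I. lborel))"
    by (simp add: algebra_simps scaleR_left_distrib)
  also have "\<dots> = (\<integral>\<^sup>+x. (\<integral>\<^sup>+t. f (P x + t *\<^sub>R e) \<partial>lborel) \<partial>(\<Pi>\<^sub>M b\<in>I. lborel))"
  proof (rule nn_integral_cong)
    fix x
    have "(\<lambda>t. f (P x + t *\<^sub>R e)) \<in> borel_measurable borel" by measurable
    from nn_integral_real_affine[OF this, of 1 "w (P x)"]
    show "(\<integral>\<^sup>+t. f (P x + (w (P x) + 1 * t) *\<^sub>R e) \<partial>lborel) = (\<integral>\<^sup>+t. f (P x + t *\<^sub>R e) \<partial>lborel)"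
      by simp
  qed
  also have "\<dots> = (\<integral>\<^sup>+x. f x \<partial>lborel)"
    by (rule int[symmetric]) simp
  finally show "(\<integral>\<^sup>+x. f x \<partial>lborel) = ennreal 1 * (\<integral>\<^sup>+x. f (x + w x *\<^sub>R e) \<partial>lborel)"
    by simp
qed simp

section \<open>The Fourier transform\<close>

definition unit_char :: "real \<Rightarrow> complex" where
  "unit_char t = exp (- (2 * of_real pi * \<i> * of_real t))"

lemma norm_unit_char [simp]: "norm (unit_char t) = 1"
  by (simp add: unit_char_def)

lemma unit_char_add: "unit_char (s + t) = unit_char s * unit_char t"
  by (simp add: unit_char_def exp_add[symmetric] algebra_simps)

lemma cnj_unit_char: "cnj (unit_char t) = unit_char (- t)"
  by (simp add: unit_char_def exp_cnj)

lemma continuous_on_unit_char [continuous_intros]: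
  "continuous_on A f \<Longrightarrow> continuous_on A (\<lambda>x. unit_char (f x))"
  unfolding unit_char_def by (intro continuous_intros)

lemma borel_measurable_unit_char [measurable]: "unit_char \<in> borel_measurable borel"
  by (intro borel_measurable_continuous_onI continuous_intros)

lemma fourier_unit_char: "fourier g \<xi> = (\<integral>x. g x * unit_char (\<xi> \<bullet> x) \<partial>lborel)"
  by (simp add: fourier_def unit_char_def)

lemma integrable_mult_unit_char:
  fixes g :: "'a::euclidean_space \<Rightarrow> complex"
  assumes g: "integrable lborel g" and [measurable]: "u \<in> borel_measurable borel"
  shows "integrable lborel (\<lambda>x. g x * unit_char (u x))"
  by (rule Bochner_Integration.integrable_bound[OF g]) (use g in \<open>auto simp: norm_mult\<close>)

section \<open>Gaussians and injectivity of the Fourier transform\<close>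

definition gauss :: "'a::euclidean_space \<Rightarrow> real" where
  "gauss x = (\<Prod>b\<in>Basis. std_normal_density (x \<bullet> b))"

lemma gauss_pos: "0 < gauss x"
  by (simp add: gauss_def prod_pos normal_density_pos)

lemma borel_measurable_gauss [measurable]: "gauss \<in> borel_measurable borel"
  unfolding gauss_def by measurable

lemma
  fixes f :: "'a::euclidean_space \<Rightarrow> real \<Rightarrow> 'b::{real_normed_field, banach, second_countable_topology}"
  assumes f: "\<And>b. b \<in> Basis \<Longrightarrow> integrable lborel (f b)"
  shows integrable_prod_Basis: "integrable lborel (\<lambda>x. \<Prod>b\<in>Basis. f b (x \<bullet> b))"
    and integral_prod_Basis:
      "(\<integral>x. (\<Prod>b\<in>Basis. f b (x \<bullet> b)) \<partial>lborel) = (\<Prod>b\<in>Basis. \<integral>x. f b x \<partial>lborel)"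
proof -
  interpret product_sigma_finite "\<lambda>_::'a. lborel :: real measure" by standard
  have [measurable]: "f b \<in> borel_measurable borel" if "b \<in> Basis" for b
    using f[OF that] by (auto dest: borel_measurable_integrable)
  have m: "(\<lambda>x. \<Prod>b\<in>Basis. f b (x \<bullet> b)) \<in> borel_measurable borel"
    by (intro borel_measurable_prod measurable_compose[OF _ \<open>_ \<Longrightarrow> f _ \<in> _\<close>]) auto
  have eq: "(\<Prod>b\<in>Basis. f b ((\<Sum>c\<in>Basis. x c *\<^sub>R c) \<bullet> b)) = (\<Prod>b\<in>Basis. f b (x b))" for x :: "'a \<Rightarrow> real"
    by (intro prod.cong) (auto simp: inner_sum_left inner_Basis if_distrib cong: if_cong)
  show "integrable lborel (\<lambda>x. \<Prod>b\<in>Basis. f b (x \<bullet> b))"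
    by (subst lborel_eq, subst integrable_distr_eq)
       (use m f in \<open>simp_all add: eq product_integrable_prod\<close>)
  show "(\<integral>x. (\<Prod>b\<in>Basis. f b (x \<bullet> b)) \<partial>lborel) = (\<Prod>b\<in>Basis. \<integral>x. f b x \<partial>lborel)"
    by (subst lborel_eq, subst integral_distr)
       (use m f in \<open>simp_all add: eq product_integral_prod\<close>)
qed

lemma integrable_gauss: "integrable lborel (gauss :: 'a::euclidean_space \<Rightarrow> real)"
  unfolding gauss_def by (intro integrable_prod_Basis) (simp add: integrable_normal_density)

lemma integral_gauss: "(\<integral>x. gauss x \<partial>lborel) = 1"
  unfolding gauss_def by (subst integral_prod_Basis) (simp_all add: integrable_normal_density)

lemma integral_std_normal_iexp:
  "(\<integral>x. of_real (std_normal_density x) * iexp (t * x) \<partial>lborel) = complex_of_real (exp (- (t\<^sup>2) / 2))"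
proof -
  have "char std_normal_distribution t = (\<integral>x. std_normal_density x *\<^sub>R iexp (t * x) \<partial>lborel)"
    unfolding char_def by (subst integral_density) (auto simp: normal_density_nonneg)
  then show ?thesis
    by (simp add: char_std_normal_distribution scaleR_conv_of_real)
qed

text \<open>The standard Gaussian is its own transform up to a constant: the integral factors over
  the coordinates, and each factor is the characteristic function of the standard normal law,
  rewritten as a multiple of its density.\<close>

lemma integral_gauss_char:
  fixes t :: "'a::euclidean_space"
  shows "(\<integral>\<xi>. of_real (gauss \<xi>) * iexp (t \<bullet> \<xi>) \<partial>lborel) =
           of_real (sqrt (2 * pi) ^ DIM('a) * gauss t)"
proof -
  have 1: "of_real (gauss \<xi>) * iexp (t \<bullet> \<xi>) =
      (\<Prod>b\<in>Basis. of_real (std_normal_density (\<xi> \<bullet> b)) * iexp ((t \<bullet> b) * (\<xi> \<bullet> b)))" for \<xi> :: 'a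
  proof -
    have "iexp (t \<bullet> \<xi>) = (\<Prod>b\<in>Basis. iexp ((t \<bullet> b) * (\<xi> \<bullet> b)))"
      by (subst euclidean_inner) (simp add: exp_sum sum_distrib_left)
    then show ?thesis by (simp add: gauss_def prod.distrib)
  qed
  have 2: "integrable lborel (\<lambda>x. of_real (std_normal_density x) * iexp (s * x))" for s :: real
    by (rule Bochner_Integration.integrable_bound[OF integrable_normal_density[of 1 0]])
       (auto simp: norm_mult)
  have 3: "(\<integral>x. of_real (std_normal_density x) * iexp (s * x) \<partial>lborel) =
      complex_of_real (sqrt (2 * pi) * std_normal_density s)" for s :: real
    by (subst integral_std_normal_iexp) (simp add: std_normal_density_def)
  have "(\<integral>\<xi>. of_real (gauss \<xi>) * iexp (t \<bullet> \<xi>) \<partial>lborel) =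
      (\<Prod>b\<in>Basis. complex_of_real (sqrt (2 * pi) * std_normal_density (t \<bullet> b)))"
    unfolding 1 by (subst integral_prod_Basis[OF 2]) (simp only: 3)
  also have "\<dots> = of_real (\<Prod>b\<in>(Basis::'a set). sqrt (2 * pi) * std_normal_density (t \<bullet> b))"
    by (simp only: of_real_prod)
  also have "\<dots> = of_real (sqrt (2 * pi) ^ DIM('a) * gauss t)"
    by (simp only: prod.distrib gauss_def prod_constant)
  finally show ?thesis .
qed

text \<open>Fubini turns the convolution of \<open>F\<close> with a Gaussian into an integral against \<open>fourier F\<close>, so that all
  Gaussian means of \<open>F\<close> vanish.\<close>

lemma fourier_injective:
  fixes F :: "'a::euclidean_space \<Rightarrow> complex"
  assumes F: "integrable lborel F" and cont: "continuous_on UNIV F"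
    and bdd: "\<And>x. norm (F x) \<le> B" and zero: "\<And>\<xi>. fourier F \<xi> = 0"
  shows "F x = 0"
proof -
  have [measurable]: "F \<in> borel_measurable borel"
    using F by (auto dest: borel_measurable_integrable)
  \<comment> \<open>This is \<open>F\<close> averaged against a Gaussian of width 1/r around
    \<open>x\<close>, already rescaled so that only the argument of \<open>F\<close> depends on
    \<open>r\<close>.\<close>
  have smooth_zero: "(\<integral>z. F (x - (1 / r) *\<^sub>R z) * of_real (gauss z) \<partial>lborel) = 0" if r: "r > 0" for r :: real
  proof -
    \<comment> \<open>Chosen so that \<open>2 * pi * s = r\<close>, which converts the kernel of
      \<open>fourier\<close> into that of a characteristic function.\<close>
    define s where "s = r / (2 * pi)"
    have s: "s > 0" using r by (simp add: s_def)
    \<comment> \<open>Integrated over \<xi> first, \<open>G\<close> yields a Gaussian mean of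
      \<open>F\<close>; integrated over \<open>y\<close> first, it yields values of
      \<open>fourier F\<close>, which are zero. The factor \<open>gauss \<xi>\<close> makes
      \<open>G\<close> absolutely integrable in both variables jointly.\<close>
    define G where "G = (\<lambda>y \<xi>. F y * of_real (gauss \<xi>) * unit_char (s * (\<xi> \<bullet> (y - x))))"
    have [measurable]: "(\<lambda>(y, \<xi>). G y \<xi>) \<in> borel_measurable (lborel \<Otimes>\<^sub>M lborel)"
      unfolding G_def by measurable
    have int: "integrable (lborel \<Otimes>\<^sub>M lborel) (\<lambda>(y, \<xi>). G y \<xi>)"
    proof (rule lborel_pair.Fubini_integrable)
      show "integrable lborel (\<lambda>y. \<integral>\<xi>. norm (case (y, \<xi>) of (y, \<xi>) \<Rightarrow> G y \<xi>) \<partial>lborel)"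
        using F gauss_pos less_imp_le by (simp add: G_def norm_mult abs_of_pos integral_gauss)
      have "integrable lborel (\<lambda>\<xi>. complex_of_real (gauss \<xi>) * unit_char (s * (\<xi> \<bullet> (y - x))))" for y
        by (rule integrable_mult_unit_char) (simp_all add: integrable_gauss)
      then show "AE y in lborel. integrable lborel (\<lambda>\<xi>. case (y, \<xi>) of (y, \<xi>) \<Rightarrow> G y \<xi>)"
        by (simp add: G_def mult.assoc)
    qed measurable
    have "(\<integral>y. (\<integral>\<xi>. G y \<xi> \<partial>lborel) \<partial>lborel) = (\<integral>\<xi>. (\<integral>y. G y \<xi> \<partial>lborel) \<partial>lborel)"
      by (rule lborel_pair.Fubini_integral[OF int, symmetric])
    also have "\<dots> = (\<integral>\<xi>. of_real (gauss \<xi>) * unit_char (- (s * (\<xi> \<bullet> x))) * fourier F (s *\<^sub>R \<xi>) \<partial>lborel)"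
    proof (rule Bochner_Integration.integral_cong[OF refl])
      fix \<xi> :: 'a
      have "(\<integral>y. G y \<xi> \<partial>lborel) =
          (\<integral>y. of_real (gauss \<xi>) * unit_char (- (s * (\<xi> \<bullet> x))) * (F y * unit_char (s *\<^sub>R \<xi> \<bullet> y)) \<partial>lborel)"
        by (rule Bochner_Integration.integral_cong[OF refl])
           (simp add: G_def inner_diff_right right_diff_distrib unit_char_add[symmetric] flip: mult.assoc)
      then show "(\<integral>y. G y \<xi> \<partial>lborel) = of_real (gauss \<xi>) * unit_char (- (s * (\<xi> \<bullet> x))) * fourier F (s *\<^sub>R \<xi>)"
        by (simp add: fourier_unit_char)
    qed
    also have "\<dots> = 0" by (simp add: zero)
    finally have 0: "(\<integral>y. (\<integral>\<xi>. G y \<xi> \<partial>lborel) \<partial>lborel) = 0" .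
    have inner: "(\<integral>\<xi>. G y \<xi> \<partial>lborel) = of_real (sqrt (2 * pi) ^ DIM('a)) * (F y * of_real (gauss (r *\<^sub>R (x - y))))" for y
    proof -
      have "unit_char (s * (\<xi> \<bullet> (y - x))) = iexp ((r *\<^sub>R (x - y)) \<bullet> \<xi>)" for \<xi>
      proof -
        have "2 * pi * s = r" by (simp add: s_def)
        then have "- (2 * pi * (s * (\<xi> \<bullet> (y - x)))) = - (r * (\<xi> \<bullet> (y - x)))"
          by (metis mult.assoc)
        then have "- (2 * pi * (s * (\<xi> \<bullet> (y - x)))) = r *\<^sub>R (x - y) \<bullet> \<xi>"
          by (simp add: inner_diff_left inner_diff_right inner_commute algebra_simps)
        then show ?thesis unfolding unit_char_def
          by (metis (no_types, opaque_lifting) mult.commute mult.left_commute mult_minus_right of_real_minus of_real_mult of_real_numeral)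
      qed
      then have "(\<integral>\<xi>. G y \<xi> \<partial>lborel) = F y * (\<integral>\<xi>. of_real (gauss \<xi>) * iexp ((r *\<^sub>R (x - y)) \<bullet> \<xi>) \<partial>lborel)"
        by (simp add: G_def mult.assoc)
      then show ?thesis by (simp only: integral_gauss_char) simp
    qed
    have "(\<integral>y. F y * of_real (gauss (r *\<^sub>R (x - y))) \<partial>lborel) = 0"
      using 0 unfolding inner by simp
    moreover have "volume_scaling (\<lambda>z. x + (- (1 / r)) *\<^sub>R z) (\<bar>- (1 / r)\<bar> ^ DIM('a))"
      using r by (intro volume_scaling_affine) simp
    from volume_scaling_integral[OF this, of "\<lambda>y. F y * of_real (gauss (r *\<^sub>R (x - y)))"]
    have "(\<integral>y. F y * of_real (gauss (r *\<^sub>R (x - y))) \<partial>lborel) =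
        (\<bar>- (1 / r)\<bar> ^ DIM('a)) *\<^sub>R (\<integral>z. F (x - (1 / r) *\<^sub>R z) * of_real (gauss z) \<partial>lborel)"
      using r by simp
    ultimately show ?thesis using r by simp
  qed
  \<comment> \<open>The means narrow to \<open>x\<close> as \<open>r\<close> runs through n + 1:
    continuity gives the pointwise limit and boundedness the majorant. Hence the conclusion holds at
    every point and not only almost everywhere.\<close>
  have lim: "(\<lambda>n. \<integral>z. F (x - (1 / real (Suc n)) *\<^sub>R z) * of_real (gauss z) \<partial>lborel)
      \<longlonglongrightarrow> (\<integral>z. F x * of_real (gauss (z::'a)) \<partial>lborel)"
  proof (rule integral_dominated_convergence[where w="\<lambda>z::'a. B * gauss z"])
    show "integrable lborel (\<lambda>z::'a. B * gauss z)" by (simp add: integrable_gauss)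
    show "AE z in lborel. (\<lambda>n. F (x - (1 / real (Suc n)) *\<^sub>R z) * of_real (gauss z)) \<longlonglongrightarrow> F x * of_real (gauss z)"
    proof (intro AE_I2 tendsto_intros)
      fix z
      have "(\<lambda>n. x - (1 / real (Suc n)) *\<^sub>R z) \<longlonglongrightarrow> x - 0 *\<^sub>R z"
        by (intro tendsto_intros LIMSEQ_Suc lim_1_over_n)
      moreover have "isCont F x" using cont by (simp add: continuous_on_eq_continuous_at)
      ultimately show "(\<lambda>n. F (x - (1 / real (Suc n)) *\<^sub>R z)) \<longlonglongrightarrow> F x"
        by (intro isCont_tendsto_compose[of x F]) simp_all
    qed
    show "AE z in lborel. norm (F (x - (1 / real (Suc n)) *\<^sub>R z) * of_real (gauss z)) \<le> B * gauss z" for n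
      using bdd by (intro AE_I2) (simp add: norm_mult gauss_pos abs_of_pos less_imp_le mult_right_mono)
  qed measurable
  have "(\<lambda>n. \<integral>z. F (x - (1 / real (Suc n)) *\<^sub>R z) * of_real (gauss z) \<partial>lborel) = (\<lambda>_. 0)"
    by (intro ext smooth_zero) simp
  then have "(\<integral>z. F x * of_real (gauss (z::'a)) \<partial>lborel) = 0"
    using lim LIMSEQ_unique tendsto_const by metis
  then have "F x * of_real (\<integral>z. gauss (z::'a) \<partial>lborel) = 0"
    by simp
  then show ?thesis by (simp only: integral_gauss) simp
qed

section \<open>Convolution with integrable functions\<close>

lemma conv_distr_of: "conv g (distr_of f) x = (\<integral>y. f y * g (x - y) \<partial>lborel)"
  by (simp add: conv_def distr_of_def)

lemma integrable_mult_bounded: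
  fixes f g :: "'a::euclidean_space \<Rightarrow> complex"
  assumes f: "integrable lborel f" and g: "g \<in> borel_measurable borel" and bdd: "\<And>x. norm (g x) \<le> B"
  shows "integrable lborel (\<lambda>x. f x * g x)"
proof (rule Bochner_Integration.integrable_bound)
  show "integrable lborel (\<lambda>x. B * norm (f x))" using f by simp
  show "AE x in lborel. norm (f x * g x) \<le> norm (B * norm (f x))"
  proof (intro AE_I2)
    fix x
    have "norm (f x * g x) = norm (g x) * norm (f x)" by (simp add: norm_mult mult.commute)
    also have "\<dots> \<le> B * norm (f x)" by (intro mult_right_mono bdd) simp
    finally show "norm (f x * g x) \<le> norm (B * norm (f x))" by (simp add: order_trans[OF _ abs_ge_self])
  qed
qed (use f g in auto)

lemma continuous_conv:
  fixes f g :: "'a::euclidean_space \<Rightarrow> complex"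
  assumes f: "integrable lborel f" and cont: "continuous_on UNIV g" and bdd: "\<And>x. norm (g x) \<le> B"
  shows "continuous_on UNIV (conv g (distr_of f))"
proof -
  have [measurable]: "f \<in> borel_measurable borel" "g \<in> borel_measurable borel"
    using f cont by (auto dest: borel_measurable_integrable intro: borel_measurable_continuous_onI)
  have "(conv g (distr_of f) \<circ> X) \<longlonglongrightarrow> conv g (distr_of f) a" if X: "X \<longlonglongrightarrow> a" for X :: "nat \<Rightarrow> 'a" and a
    unfolding comp_def conv_distr_of
  proof (rule integral_dominated_convergence[where w="\<lambda>y. B * norm (f y)"])
    show "AE y in lborel. (\<lambda>n. f y * g (X n - y)) \<longlonglongrightarrow> f y * g (a - y)"
    proof (intro AE_I2 tendsto_intros)
      fix y
      have "isCont g (a - y)" using cont by (simp add: continuous_on_eq_continuous_at)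
      then show "(\<lambda>n. g (X n - y)) \<longlonglongrightarrow> g (a - y)"
        by (rule isCont_tendsto_compose) (intro tendsto_intros X)
    qed
    show "AE y in lborel. norm (f y * g (X n - y)) \<le> B * norm (f y)" for n
      by (intro AE_I2) (metis bdd mult.commute mult_right_mono norm_ge_zero norm_mult)
  qed (use f in auto)
  then show ?thesis
    unfolding continuous_on_sequentially by auto
qed

lemma
  fixes f g :: "'a::euclidean_space \<Rightarrow> complex"
  assumes f: "integrable lborel f" and g: "integrable lborel g"
  shows integrable_conv: "integrable lborel (conv g (distr_of f))"
    and fourier_conv: "fourier (conv g (distr_of f)) \<xi> = fourier f \<xi> * fourier g \<xi>"
proof -
  have [measurable]: "f \<in> borel_measurable borel" "g \<in> borel_measurable borel"
    using f g by (auto dest: borel_measurable_integrable)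
  have shift: "integrable lborel (\<lambda>x. h (x - y)) \<longleftrightarrow> integrable lborel h"
      "(\<integral>x. h (x - y) \<partial>lborel) = (\<integral>x. h x \<partial>lborel)"
    if "h \<in> borel_measurable borel" for h :: "'a \<Rightarrow> complex" and y
  proof -
    have "volume_scaling (\<lambda>x. - y + 1 *\<^sub>R x) (\<bar>1\<bar> ^ DIM('a))"
      by (rule volume_scaling_affine) simp
    then have 1: "volume_scaling (\<lambda>x. x - y) 1" by simp
    show "integrable lborel (\<lambda>x. h (x - y)) \<longleftrightarrow> integrable lborel h"
      "(\<integral>x. h (x - y) \<partial>lborel) = (\<integral>x. h x \<partial>lborel)"
      using volume_scaling_integrable_iff[OF 1 that] volume_scaling_integral[OF 1 that] by auto
  qed
  \<comment> \<open>The unimodular factors let one application of Fubini serve twice: with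
    \<open>u\<close> and \<open>v\<close> equal to 1 it gives integrability of the convolution, with
    characters it gives the product formula.\<close>
  have int: "integrable (lborel \<Otimes>\<^sub>M lborel) (\<lambda>(y, x). f y * u y * (g (x - y) * v (x - y)))"
    if [measurable]: "u \<in> borel_measurable borel" "v \<in> borel_measurable borel"
      and 1: "\<And>x. norm (u x) = 1" "\<And>x. norm (v x) = 1" for u v :: "'a \<Rightarrow> complex"
  proof -
    have "integrable lborel (\<lambda>x. norm (g (x - y)))" for y
      using shift(1)[of g y] g by simp
    moreover have "(\<integral>x. norm (g (x - y)) \<partial>lborel) = (\<integral>x. norm (g x) \<partial>lborel)" for y
    proof -
      have "volume_scaling (\<lambda>x. - y + 1 *\<^sub>R x) (\<bar>1\<bar> ^ DIM('a))"
        by (rule volume_scaling_affine) simp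
      from volume_scaling_integral[OF this, of "\<lambda>x. norm (g x)"] show ?thesis by simp
    qed
    moreover have "integrable lborel (\<lambda>x. f y * u y * (g (x - y) * v (x - y)))" for y
    proof -
      have "integrable lborel (\<lambda>x. g x * v x)"
        by (rule integrable_mult_bounded[OF g, of _ 1]) (simp_all add: 1)
      then have "integrable lborel (\<lambda>x. g (x - y) * v (x - y))"
        using shift(1)[of "\<lambda>x. g x * v x" y] by simp
      then show ?thesis by simp
    qed
    ultimately show ?thesis
      using f by (intro lborel_pair.Fubini_integrable) (auto simp: norm_mult 1)
  qed
  have "integrable lborel (\<lambda>x. \<integral>y. f y * 1 * (g (x - y) * 1) \<partial>lborel)"
    using lborel_pair.integrable_snd[OF int[of "\<lambda>_. 1" "\<lambda>_. 1"]] by (simp add: split_beta)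
  then show "integrable lborel (conv g (distr_of f))"
    by (simp add: conv_distr_of[abs_def])
  define G where "G = (\<lambda>y x. f y * unit_char (\<xi> \<bullet> y) * (g (x - y) * unit_char (\<xi> \<bullet> (x - y))))"
  have iG: "integrable (lborel \<Otimes>\<^sub>M lborel) (\<lambda>(y, x). G y x)"
    unfolding G_def by (rule int) simp_all
  have "fourier (conv g (distr_of f)) \<xi> = (\<integral>x. (\<integral>y. G y x \<partial>lborel) \<partial>lborel)"
    unfolding fourier_unit_char conv_distr_of
  proof (intro Bochner_Integration.integral_cong[OF refl])
    fix x
    have "unit_char (\<xi> \<bullet> x) = unit_char (\<xi> \<bullet> y) * unit_char (\<xi> \<bullet> (x - y))" for y
      by (simp add: unit_char_add[symmetric] inner_diff_right)
    then have "(\<integral>y. f y * g (x - y) * unit_char (\<xi> \<bullet> x) \<partial>lborel) = (\<integral>y. G y x \<partial>lborel)"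
      unfolding G_def by (intro Bochner_Integration.integral_cong[OF refl]) (metis mult.assoc mult.commute)
    then show "(\<integral>y. f y * g (x - y) \<partial>lborel) * unit_char (\<xi> \<bullet> x) = (\<integral>y. G y x \<partial>lborel)"
      by simp
  qed
  also have "\<dots> = (\<integral>y. (\<integral>x. G y x \<partial>lborel) \<partial>lborel)"
    by (rule lborel_pair.Fubini_integral[OF iG])
  also have "\<dots> = (\<integral>y. f y * unit_char (\<xi> \<bullet> y) * fourier g \<xi> \<partial>lborel)"
    unfolding G_def fourier_unit_char
    using shift(2)[of "\<lambda>x. g x * unit_char (\<xi> \<bullet> x)"] by simp
  also have "\<dots> = fourier f \<xi> * fourier g \<xi>"
    by (simp add: fourier_unit_char)
  finally show "fourier (conv g (distr_of f)) \<xi> = fourier f \<xi> * fourier g \<xi>" .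
qed

lemma norm_conv_le:
  fixes f g :: "'a::euclidean_space \<Rightarrow> complex"
  assumes f: "integrable lborel f" and g: "g \<in> borel_measurable borel" and bdd: "\<And>x. norm (g x) \<le> B"
  shows "norm (conv g (distr_of f) x) \<le> B * (\<integral>y. norm (f y) \<partial>lborel)"
proof -
  have [measurable]: "f \<in> borel_measurable borel" "g \<in> borel_measurable borel"
    using f g by (auto dest: borel_measurable_integrable)
  have "norm (conv g (distr_of f) x) \<le> (\<integral>y. norm (f y * g (x - y)) \<partial>lborel)"
    unfolding conv_distr_of by (rule integral_norm_bound)
  also have "\<dots> \<le> (\<integral>y. B * norm (f y) \<partial>lborel)"
  proof (intro integral_mono integrable_norm integrable_mult_bounded[OF f, of _ B])
    show "norm (f y * g (x - y)) \<le> B * norm (f y)" for y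
      by (metis bdd mult.commute mult_right_mono norm_ge_zero norm_mult)
  qed (use f bdd in auto)
  finally show ?thesis by simp
qed

text \<open>The convolution is integrable, continuous and bounded, and its transform is the product
  of the two transforms, which vanishes; injectivity then gives zero at every point. This discards
  all scales except a bounded number.\<close>

lemma conv_eq_0_if_fourier_disjoint:
  fixes f g :: "'a::euclidean_space \<Rightarrow> complex"
  assumes "integrable lborel f" "integrable lborel g" "continuous_on UNIV g" "\<And>x. norm (g x) \<le> B"
    and "\<And>\<xi>. fourier f \<xi> = 0 \<or> fourier g \<xi> = 0"
  shows "conv g (distr_of f) x = 0"
proof (rule fourier_injective[OF integrable_conv continuous_conv norm_conv_le])
  show "fourier (conv g (distr_of f)) \<xi> = 0" for \<xi>
    using assms by (subst fourier_conv) auto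
qed (use assms in \<open>auto intro: borel_measurable_continuous_onI\<close>)

section \<open>Decay estimates\<close>

text \<open>With twice the dimension as threshold, the tensor product of the functions 1 / (1 + t^2)
  is a majorant, since 1 + (x \<bullet> b)^2 \<le> (1 + norm x)^2 for each basis vector
  \<open>b\<close>.\<close>

lemma integrable_one_plus_norm_powr:
  assumes s: "s \<ge> 2 * real DIM('a)"
  shows "integrable lborel (\<lambda>x::'a::euclidean_space. (1 + norm x) powr (- s))"
proof (rule Bochner_Integration.integrable_bound)
  have "integrable lborel (\<lambda>x::real. inverse (1 + x\<^sup>2))"
    using integrable_inverse_1_plus_square by (simp add: set_integrable_def einterval_def)
  then show "integrable lborel (\<lambda>x::'a. \<Prod>b\<in>Basis. inverse (1 + (x \<bullet> b)\<^sup>2))"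
    by (intro integrable_prod_Basis)
  show "AE x::'a in lborel. norm ((1 + norm x) powr (- s)) \<le> norm (\<Prod>b\<in>Basis. inverse (1 + (x \<bullet> b)\<^sup>2))"
  proof (intro AE_I2)
    fix x :: 'a
    have "1 + (x \<bullet> b)\<^sup>2 \<le> (1 + norm x)\<^sup>2" if "b \<in> Basis" for b
    proof -
      have "\<bar>x \<bullet> b\<bar> \<le> norm x" using Basis_le_norm that by blast
      then have "(x \<bullet> b)\<^sup>2 \<le> (norm x)\<^sup>2" by (metis power2_abs power_mono abs_ge_zero)
      then show ?thesis unfolding power2_sum by (simp add: add_increasing2)
    qed
    then have "(\<Prod>b\<in>Basis. 1 + (x \<bullet> b)\<^sup>2) \<le> (\<Prod>b\<in>(Basis::'a set). (1 + norm x)\<^sup>2)"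
      by (intro prod_mono) auto
    also have "\<dots> = (1 + norm x) ^ (2 * DIM('a))" by (simp add: power_mult)
    also have "\<dots> = (1 + norm x) powr (real (2 * DIM('a)))"
      by (subst powr_realpow) (auto intro: add_pos_nonneg)
    also have "\<dots> \<le> (1 + norm x) powr s" using s by (intro powr_mono) auto
    finally have "inverse ((1 + norm x) powr s) \<le> inverse (\<Prod>b\<in>Basis. 1 + (x \<bullet> b)\<^sup>2)"
      by (intro le_imp_inverse_le prod_pos) (auto intro: add_pos_nonneg)
    then show "norm ((1 + norm x) powr (- s)) \<le> norm (\<Prod>b\<in>Basis. inverse (1 + (x \<bullet> b)\<^sup>2))"
      by (simp add: powr_minus prod_inversef[unfolded comp_def] prod_nonneg abs_of_nonneg abs_prod)
  qed
qed measurable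

text \<open>This keeps from the Schwartz class what integrals see, continuity and decay. The class
  is stable under linear substitutions by a direct estimate, without iterated derivatives of a
  composition.\<close>

definition rapidly_decreasing :: "('a::euclidean_space \<Rightarrow> complex) \<Rightarrow> bool" where
  "rapidly_decreasing g \<longleftrightarrow>
     continuous_on UNIV g \<and> (\<forall>N::nat. \<exists>D. \<forall>x. norm (g x) * (1 + norm x) ^ N \<le> D)"

lemma rapidly_decreasing_schwartz:
  assumes "g \<in> schwartz" shows "rapidly_decreasing g"
proof -
  have "g differentiable_on UNIV" using assms unfolding schwartz_def smooth_def
    by (metis (mono_tags, lifting) empty_subsetI iter_pderiv.simps(1) list.set(1) mem_Collect_eq)
  moreover have "\<exists>D. \<forall>x. norm (g x) * (1 + norm x) ^ N \<le> D" for N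
  proof -
    have "set ([]::'a list) \<subseteq> Basis" by simp
    then have "bounded (range (\<lambda>x. (1 + norm x) ^ N * norm (iter_pderiv [] g x)))"
      using assms unfolding schwartz_def by blast
    then obtain D where "\<And>x. \<bar>(1 + norm x) ^ N * norm (g x)\<bar> \<le> D"
      unfolding bounded_iff by auto
    then show ?thesis by (metis abs_le_D1 mult.commute)
  qed
  ultimately show ?thesis
    unfolding rapidly_decreasing_def by (auto intro: differentiable_imp_continuous_on)
qed

lemma rapidly_decreasing_measurable [measurable_dest]:
  "rapidly_decreasing g \<Longrightarrow> g \<in> borel_measurable borel"
  by (auto simp: rapidly_decreasing_def intro: borel_measurable_continuous_onI)

lemma rapidly_decreasing_decay:
  assumes "rapidly_decreasing g"
  obtains D where "0 \<le> D" "\<And>x. norm (g x) \<le> D / (1 + norm x) ^ N"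
proof -
  obtain D where D: "\<And>x. norm (g x) * (1 + norm x) ^ N \<le> D"
    using assms unfolding rapidly_decreasing_def by meson
  have "0 \<le> norm (g 0) * (1 + norm (0::'a)) ^ N" by simp
  also have "\<dots> \<le> D" by (rule D)
  finally have "0 \<le> D" .
  moreover have "norm (g x) \<le> D / (1 + norm x) ^ N" for x
    using D[of x] by (subst pos_le_divide_eq) (auto intro!: zero_less_power add_pos_nonneg)
  ultimately show ?thesis using that by blast
qed

lemma rapidly_decreasing_bounded:
  assumes "rapidly_decreasing g"
  obtains D where "\<And>x. norm (g x) \<le> D"
proof -
  obtain D where "\<And>x. norm (g x) \<le> D / (1 + norm x) ^ 0"
    using rapidly_decreasing_decay[OF assms, of 0] by blast
  then show ?thesis by (intro that[of D]) simp
qed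

lemma integrable_rapidly_decreasing_moment:
  assumes g: "rapidly_decreasing (g :: 'a::euclidean_space \<Rightarrow> complex)"
  shows "integrable lborel (\<lambda>x. norm (g x) * (1 + norm x) ^ N)"
proof -
  have [measurable]: "g \<in> borel_measurable borel" using g by (rule rapidly_decreasing_measurable)
  \<comment> \<open>The \<open>2 * DIM('a)\<close> additional powers pay for integrability at
    infinity.\<close>
  obtain D where D: "0 \<le> D" "\<And>x. norm (g x) \<le> D / (1 + norm x) ^ (N + 2 * DIM('a))"
    using rapidly_decreasing_decay[OF g] by blast
  show ?thesis
  proof (rule Bochner_Integration.integrable_bound)
    show "integrable lborel (\<lambda>x::'a. D * (1 + norm x) powr (- (2 * real DIM('a))))"
      by (intro integrable_mult_right integrable_one_plus_norm_powr) simp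
    show "AE x in lborel. norm (norm (g x) * (1 + norm x) ^ N) \<le> norm (D * (1 + norm x) powr (- (2 * real DIM('a))))"
    proof (intro AE_I2)
      fix x :: 'a
      have p: "0 < 1 + norm x" by (simp add: add_pos_nonneg)
      have "norm (g x) * (1 + norm x) ^ N \<le> D / (1 + norm x) ^ (N + 2 * DIM('a)) * (1 + norm x) ^ N"
        using p by (intro mult_right_mono D) simp
      also have "\<dots> = D / (1 + norm x) ^ (2 * DIM('a))"
        using p by (simp add: power_add)
      also have "\<dots> = D * (1 + norm x) powr (- (2 * real DIM('a)))"
        using powr_realpow[OF p, of "2 * DIM('a)"] by (simp add: powr_minus field_simps)
      finally show "norm (norm (g x) * (1 + norm x) ^ N) \<le> norm (D * (1 + norm x) powr (- (2 * real DIM('a))))"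
        using D(1) p by (simp add: abs_mult)
    qed
  qed measurable
qed

lemma integrable_rapidly_decreasing:
  assumes g: "rapidly_decreasing (g :: 'a::euclidean_space \<Rightarrow> complex)"
  shows "integrable lborel g"
proof -
  have [measurable]: "g \<in> borel_measurable borel" using g by (rule rapidly_decreasing_measurable)
  show ?thesis
    using integrable_rapidly_decreasing_moment[OF g, of 0] by (simp add: integrable_norm_iff)
qed

text \<open>The hypothesis with \<open>K\<close> bounds \<open>T\<close> from below, so points far
  out remain far out under \<open>T\<close>; the decay constant deteriorates by (1 + |K|)^N and by
  the norm of \<open>a\<close>.\<close>

lemma rapidly_decreasing_linear_image:
  assumes g: "rapidly_decreasing g" and T: "linear T" and K: "\<And>x. norm x \<le> K * norm (T x)"
  shows "rapidly_decreasing (\<lambda>x. a * g (T x))"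
  unfolding rapidly_decreasing_def
proof (intro conjI allI)
  have "continuous_on UNIV g" using g by (simp add: rapidly_decreasing_def)
  moreover have "continuous_on UNIV T" using T by (simp add: linear_continuous_on linear_linear)
  ultimately show "continuous_on UNIV (\<lambda>x. a * g (T x))"
    by (intro continuous_on_mult_left continuous_on_compose2[of UNIV g _ T]) auto
  fix N :: nat
  obtain D where D: "0 \<le> D" "\<And>x. norm (g x) \<le> D / (1 + norm x) ^ N"
    using rapidly_decreasing_decay[OF g] by blast
  have "norm (a * g (T x)) * (1 + norm x) ^ N \<le> norm a * D * (1 + \<bar>K\<bar>) ^ N" for x
  proof -
    have "norm x \<le> \<bar>K\<bar> * norm (T x)"
      using K[of x] by (rule order_trans) (intro mult_right_mono, auto)
    then have "1 + norm x \<le> (1 + \<bar>K\<bar>) * (1 + norm (T x))" 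
      by (simp add: algebra_simps) (use norm_ge_zero[of "T x"] in linarith)
    then have "(1 + norm x) ^ N \<le> (1 + \<bar>K\<bar>) ^ N * (1 + norm (T x)) ^ N"
      by (subst power_mult_distrib[symmetric]) (intro power_mono, auto)
    then have "norm (g (T x)) * (1 + norm x) ^ N \<le> D / (1 + norm (T x)) ^ N * ((1 + \<bar>K\<bar>) ^ N * (1 + norm (T x)) ^ N)"
      using D by (intro mult_mono) auto
    also have "\<dots> = D * (1 + \<bar>K\<bar>) ^ N"
    proof -
      have "(1 + norm (T x)) ^ N \<noteq> 0"
        by (intro power_not_zero add_pos_nonneg[THEN less_imp_neq, symmetric]) auto
      then show ?thesis by (simp add: field_simps del: power_eq_0_iff)
    qed
    finally show ?thesis by (simp add: norm_mult mult.assoc mult_left_mono)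
  qed
  then show "\<exists>D. \<forall>x. norm (a * g (T x)) * (1 + norm x) ^ N \<le> D" by blast
qed

text \<open>The pairing with \<open>g\<close> is at most the L^1 norm of \<open>f\<close> times the
  supremum of |g|, and that supremum is the Schwartz seminorm without weight and without
  derivatives.\<close>

lemma tempered_function_rapidly_decreasing:
  assumes f: "rapidly_decreasing (f :: 'a::euclidean_space \<Rightarrow> complex)"
  shows "tempered_function f"
proof -
  have [measurable]: "f \<in> borel_measurable borel" using f by (rule rapidly_decreasing_measurable)
  have intf: "integrable lborel f" using f by (rule integrable_rapidly_decreasing)
  have int: "integrable lborel (\<lambda>x. f x * g x)" if "g \<in> schwartz" for g
  proof -
    have g: "rapidly_decreasing g" using that by (rule rapidly_decreasing_schwartz)
    then obtain D where "\<And>x. norm (g x) \<le> D" using rapidly_decreasing_bounded by blast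
    then show ?thesis
      using integrable_mult_bounded[OF intf] rapidly_decreasing_measurable[OF g] by blast
  qed
  have "tempered_distribution (distr_of f)"
    unfolding tempered_distribution_def
  proof (intro conjI ballI allI impI)
    fix g h :: "'a \<Rightarrow> complex" and a b :: complex assume gh: "g \<in> schwartz" "h \<in> schwartz"
    have "distr_of f (\<lambda>x. a * g x + b * h x) = (\<integral>x. a * (f x * g x) + b * (f x * h x) \<partial>lborel)"
      unfolding distr_of_def by (intro Bochner_Integration.integral_cong) (auto simp: algebra_simps)
    also have "\<dots> = a * distr_of f g + b * distr_of f h"
      unfolding distr_of_def using int[OF gh(1)] int[OF gh(2)] by simp
    finally show "distr_of f (\<lambda>x. a * g x + b * h x) = a * distr_of f g + b * distr_of f h" .
  next
    fix g :: "nat \<Rightarrow> 'a \<Rightarrow> complex"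
    assume g: "(\<forall>n. g n \<in> schwartz) \<and>
        (\<forall>k bs. set bs \<subseteq> Basis \<longrightarrow> (\<lambda>n. schwartz_seminorm k bs (g n)) \<longlonglongrightarrow> 0)"
    define S where "S n = schwartz_seminorm 0 [] (g n)" for n
    have S: "S \<longlonglongrightarrow> 0"
    proof -
      have "(\<lambda>n. schwartz_seminorm 0 [] (g n)) \<longlonglongrightarrow> 0"
        using g by (metis empty_subsetI list.set(1))
      then show ?thesis by (simp add: S_def[abs_def])
    qed
    have gS: "norm (g n x) \<le> S n" for n x
    proof -
      obtain D where "\<And>x. norm (g n x) \<le> D"
        using g rapidly_decreasing_schwartz rapidly_decreasing_bounded by metis
      then have "bdd_above (range (\<lambda>x. norm (g n x)))" by (rule bdd_aboveI2)
      from cSUP_upper[OF UNIV_I this] show ?thesis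
        by (simp add: S_def schwartz_seminorm_def)
    qed
    show "(\<lambda>n. distr_of f (g n)) \<longlonglongrightarrow> 0"
    proof (rule Lim_null_comparison)
      show "(\<lambda>n. S n * (\<integral>x. norm (f x) \<partial>lborel)) \<longlonglongrightarrow> 0"
        using tendsto_mult_right[OF S, of "\<integral>x. norm (f x) \<partial>lborel"] by simp
      show "\<forall>\<^sub>F n in sequentially. norm (distr_of f (g n)) \<le> S n * (\<integral>x. norm (f x) \<partial>lborel)"
      proof (intro always_eventually allI)
        fix n
        have "norm (distr_of f (g n)) \<le> (\<integral>x. norm (f x * g n x) \<partial>lborel)"
          unfolding distr_of_def by (rule integral_norm_bound)
        also have "\<dots> \<le> (\<integral>x. S n * norm (f x) \<partial>lborel)"
        proof (rule integral_mono')
          show "norm (f x * g n x) \<le> S n * norm (f x)" for x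
            by (metis gS mult.commute mult_right_mono norm_ge_zero norm_mult)
        qed (use intf order_trans[OF norm_ge_zero gS] in auto)
        finally show "norm (distr_of f (g n)) \<le> S n * (\<integral>x. norm (f x) \<partial>lborel)" by simp
      qed
    qed
  qed
  then show ?thesis using int by (simp add: tempered_function_def)
qed

text \<open>For all \<open>y\<close>, 1 + r |x| is at most a constant times (1 + |T (x - y)|) (1 + R
  |y|): the decay of \<open>f\<close> pays for the second factor and a moment of \<open>g\<close>
  for the first. The kernel is normalised in L^1, so its Jacobian drops out and the amplitude
  \<open>D\<close> survives. \<open>T\<close> enters the bound only through \<open>K\<close>, which
  gives uniformity over dilations and shears. The scale 1/r of the result is, up to constants, at
  least as coarse as the scales of both factors.\<close>

lemma norm_conv_decay:
  fixes f g :: "'a::euclidean_space \<Rightarrow> complex"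
  assumes T: "volume_scaling T c" and TK: "\<And>y. r * norm y \<le> K * norm (T y)" and rR: "r \<le> K' * R"
    and g: "rapidly_decreasing g" and f: "\<And>y. norm (f y) \<le> D / (1 + R * norm y) ^ N"
    and nonneg: "0 \<le> r" "0 \<le> R" "0 \<le> K" "0 \<le> K'" "0 \<le> D"
  shows "norm (conv (\<lambda>y. of_real c * g (T y)) (distr_of f) x) \<le>
    D * ((1 + K) * (1 + K')) ^ N * (\<integral>z. norm (g z) * (1 + norm z) ^ N \<partial>lborel) / (1 + r * norm x) ^ N"
proof -
  have c: "0 < c" using T by (rule volume_scaling_pos)
  have Tx: "volume_scaling (\<lambda>y. T (x - y)) c"
    using volume_scaling_compose[OF T volume_scaling_diff[of x]] by simp
  define E where "E = D * ((1 + K) * (1 + K')) ^ N / (1 + r * norm x) ^ N"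
  define w where "w = (\<lambda>z. norm (g z) * (1 + norm z) ^ N)"
  have w: "integrable lborel w" unfolding w_def by (rule integrable_rapidly_decreasing_moment[OF g])
  have [measurable]: "w \<in> borel_measurable borel" using w by auto
  have ww: "(\<integral>z. w z \<partial>lborel) = c * (\<integral>y. w (T (x - y)) \<partial>lborel)"
    using volume_scaling_integral[OF Tx, of w] by simp
  have iw: "integrable lborel (\<lambda>y. w (T (x - y)))"
    using volume_scaling_integrable_iff[OF Tx, of w] w by simp
  have pt: "norm (f y * (of_real c * g (T (x - y)))) \<le> E * c * w (T (x - y))" for y
  proof -
    have "r * norm x \<le> r * norm (x - y) + r * norm y"
      using nonneg norm_triangle_ineq[of "x - y" y] by (simp flip: distrib_left add: mult_left_mono)
    moreover have "r * norm y \<le> K' * (R * norm y)"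
      using rR mult_right_mono[of r "K' * R" "norm y"] by (simp add: mult.assoc)
    ultimately have "1 + r * norm x \<le> 1 + K * norm (T (x - y)) + K' * (R * norm y)"
      using TK[of "x - y"] by linarith
    also have "\<dots> \<le> ((1 + K) * (1 + norm (T (x - y)))) * ((1 + K') * (1 + R * norm y))"
    proof -
      define a b where "a = norm (T (x - y))" and "b = R * norm y"
      have ab: "0 \<le> a" "0 \<le> b" using nonneg by (auto simp: a_def b_def)
      have "1 + K * a \<le> (1 + K) * (1 + a)" "1 + K' * b \<le> (1 + K') * (1 + b)"
        using ab nonneg by (auto simp: algebra_simps)
      then have "(1 + K * a) * (1 + K' * b) \<le> ((1 + K) * (1 + a)) * ((1 + K') * (1 + b))"
        using ab nonneg by (intro mult_mono) auto
      moreover have "1 + K * a + K' * b \<le> (1 + K * a) * (1 + K' * b)"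
        using ab nonneg by (simp add: algebra_simps)
      ultimately show ?thesis unfolding a_def b_def by linarith
    qed
    also have "\<dots> = ((1 + K) * (1 + K')) * ((1 + norm (T (x - y))) * (1 + R * norm y))"
      by (simp add: algebra_simps)
    finally have "(1 + r * norm x) ^ N \<le> ((1 + K) * (1 + K')) ^ N * ((1 + norm (T (x - y))) ^ N * (1 + R * norm y) ^ N)"
      using nonneg by (subst power_mult_distrib[symmetric])+ (intro power_mono, auto)
    moreover have p: "0 < (1 + r * norm x) ^ N" "0 < (1 + R * norm y) ^ N"
      using nonneg by (auto intro!: zero_less_power add_pos_nonneg)
    ultimately have "D / (1 + R * norm y) ^ N \<le> E * (1 + norm (T (x - y))) ^ N"
      unfolding E_def using nonneg
      by (simp add: field_simps) (use mult_left_mono[OF _ nonneg(5)] in \<open>fastforce simp: algebra_simps\<close>)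
    then have "norm (f y) \<le> E * (1 + norm (T (x - y))) ^ N"
      using f[of y] by simp
    then have "norm (f y) * (c * norm (g (T (x - y)))) \<le> (E * (1 + norm (T (x - y))) ^ N) * (c * norm (g (T (x - y))))"
      using c by (intro mult_right_mono) auto
    then show ?thesis using c by (simp add: norm_mult w_def algebra_simps)
  qed
  have "norm (conv (\<lambda>y. of_real c * g (T y)) (distr_of f) x) \<le> (\<integral>y. norm (f y * (of_real c * g (T (x - y)))) \<partial>lborel)"
    unfolding conv_distr_of by (rule integral_norm_bound)
  also have "\<dots> \<le> (\<integral>y. E * c * w (T (x - y)) \<partial>lborel)"
  proof (rule integral_mono')
    show "integrable lborel (\<lambda>y. E * c * w (T (x - y)))" using iw by simp
  qed (use pt order_trans[OF norm_ge_zero pt] in auto)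
  also have "\<dots> = E * (\<integral>z. w z \<partial>lborel)" using ww by simp
  finally show ?thesis by (simp add: E_def w_def)
qed

section \<open>Mixed quasi-norms\<close>

lemma enn_powr_ennreal: "0 \<le> x \<Longrightarrow> enn_powr (ennreal x) r = ennreal (x powr r)"
  by (simp add: enn_powr_def)

lemma enn_powr_0 [simp]: "enn_powr 0 r = 0"
  by (simp add: enn_powr_def)

lemma enn_powr_mono:
  assumes "x \<le> y" "0 \<le> r" shows "enn_powr x r \<le> enn_powr y r"
proof (cases "y = \<infinity>")
  case False
  then have "x \<noteq> \<infinity>" using assms by (auto simp: top_unique)
  then show ?thesis using False assms
    by (auto simp: enn_powr_def less_top intro!: ennreal_leI powr_mono2 enn2real_mono)
qed (simp add: enn_powr_def)

lemma enn_powr_powr_inverse: "0 < r \<Longrightarrow> enn_powr (enn_powr x r) (1 / r) = x"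
  by (cases x) (auto simp: enn_powr_def powr_powr)

lemma Lp_norm_mono:
  assumes "\<And>x. G x \<le> H x" "0 < p" shows "Lp_norm p G \<le> Lp_norm p H"
  unfolding Lp_norm_def
  using assms by (intro enn_powr_mono nn_integral_mono) auto

lemma Lp_norm_eq_0: "0 < p \<Longrightarrow> Lp_norm p (\<lambda>_. 0) = 0"
  by (simp add: Lp_norm_def)

text \<open>Substituting \<open>r *\<^sub>R x\<close> isolates the power of \<open>r\<close> and
  leaves an integral that depends on neither \<open>r\<close> nor \<open>B\<close>. Its convergence
  is secured by the condition on \<open>N * p\<close>, so a small \<open>p\<close> calls for a large
  \<open>N\<close>.\<close>

lemma Lp_norm_decay:
  assumes p: "0 < p" and N: "2 * real DIM('a) \<le> real N * p" and r: "0 < r" and B: "0 \<le> B"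
  shows "Lp_norm p (\<lambda>x::'a::euclidean_space. ennreal (B / (1 + r * norm x) ^ N)) =
    ennreal (B * r powr (- real DIM('a) / p) *
      (\<integral>x. (1 + norm (x::'a)) powr (- (real N * p)) \<partial>lborel) powr (1 / p))"
proof -
  define J where "J = (\<integral>x. (1 + norm (x::'a)) powr (- (real N * p)) \<partial>lborel)"
  have J: "0 \<le> J" unfolding J_def by simp
  have S: "volume_scaling (\<lambda>x::'a. r *\<^sub>R x) (r ^ DIM('a))" using r by (rule volume_scaling_scaleR)
  have "(\<integral>\<^sup>+x. ennreal ((1 + norm (x::'a)) powr (- (real N * p))) \<partial>lborel) = ennreal J"
    unfolding J_def using N by (intro nn_integral_eq_integral integrable_one_plus_norm_powr) auto
  then have 1: "ennreal (r ^ DIM('a)) * (\<integral>\<^sup>+x. ennreal ((1 + r * norm (x::'a)) powr (- (real N * p))) \<partial>lborel) = ennreal J"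
    using volume_scaling_nn_integral[OF S, of "\<lambda>x. ennreal ((1 + norm x) powr (- (real N * p)))"] r by simp
  have 2: "(\<integral>\<^sup>+x. ennreal ((1 + r * norm (x::'a)) powr (- (real N * p))) \<partial>lborel) = ennreal (J / r ^ DIM('a))"
  proof -
    have "ennreal (1 / r ^ DIM('a)) * (ennreal (r ^ DIM('a)) * (\<integral>\<^sup>+x. ennreal ((1 + r * norm (x::'a)) powr (- (real N * p))) \<partial>lborel))
        = (\<integral>\<^sup>+x. ennreal ((1 + r * norm (x::'a)) powr (- (real N * p))) \<partial>lborel)"
      using r by (simp add: mult.assoc[symmetric] ennreal_mult[symmetric])
    then show ?thesis using r J by (simp add: 1 ennreal_mult[symmetric])
  qed
  have 3: "enn_powr (ennreal (B / (1 + r * norm x) ^ N)) p = ennreal (B powr p) * ennreal ((1 + r * norm x) powr (- (real N * p)))"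
    for x :: 'a
  proof -
    have pos: "0 < 1 + r * norm x" using r by (simp add: add_pos_nonneg)
    have "(B / (1 + r * norm x) ^ N) powr p = B powr p / ((1 + r * norm x) powr real N) powr p"
      using B pos by (simp add: powr_divide powr_realpow)
    also have "\<dots> = B powr p * (1 + r * norm x) powr (- (real N * p))"
      by (simp add: powr_powr powr_minus divide_inverse)
    finally show ?thesis using B pos
      by (simp add: enn_powr_ennreal ennreal_mult[symmetric])
  qed
  have "Lp_norm p (\<lambda>x::'a. ennreal (B / (1 + r * norm x) ^ N)) = enn_powr (ennreal (B powr p * (J / r ^ DIM('a)))) (1 / p)"
    unfolding Lp_norm_def 3 using J r
    by (subst nn_integral_cmult) (simp_all add: 2 ennreal_mult[symmetric])
  also have "\<dots> = ennreal ((B powr p * (J / r powr real DIM('a))) powr (1 / p))"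
    using J r by (simp add: enn_powr_ennreal powr_realpow)
  also have "(B powr p * (J / r powr real DIM('a))) powr (1 / p) = B * r powr (- real DIM('a) / p) * J powr (1 / p)"
    using J r B p by (simp add: powr_mult powr_divide powr_powr powr_minus divide_inverse inverse_powr)
  finally show ?thesis by (simp add: J_def)
qed

text \<open>Here \<open>r\<close> is a radius, in \<open>Lp_norm_decay\<close> it is the inverse of
  a width; both quasi-norms scale like the width to the power d/p, which is why upper and lower
  bounds will match.\<close>

lemma Lp_norm_indicator_ball:
  assumes p: "0 < p" and r: "0 < r" and m: "0 \<le> m"
  shows "Lp_norm p (\<lambda>x::'a::euclidean_space. ennreal (m * indicator (ball 0 r) x)) =
    ennreal (m * r powr (real DIM('a) / p) * measure lborel (ball (0::'a) 1) powr (1 / p))"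
proof -
  have S: "volume_scaling (\<lambda>x::'a. r *\<^sub>R x) (r ^ DIM('a))" using r by (rule volume_scaling_scaleR)
  have "indicator (ball 0 r) (r *\<^sub>R x) = (indicator (ball 0 1) x :: ennreal)" for x :: 'a
    using r by (auto simp: indicator_def)
  then have "emeasure lborel (ball (0::'a) r) = ennreal (r ^ DIM('a)) * emeasure lborel (ball (0::'a) 1)"
    using volume_scaling_nn_integral[OF S borel_measurable_indicator[of "ball 0 r"]] by simp
  also have "emeasure lborel (ball (0::'a) 1) = ennreal (measure lborel (ball (0::'a) 1))"
    by (rule emeasure_eq_ennreal_measure) (metis emeasure_lborel_ball_finite infinity_ennreal_def less_irrefl)
  finally have 1: "emeasure lborel (ball (0::'a) r) = ennreal (r ^ DIM('a) * measure lborel (ball (0::'a) 1))"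
    using r by (simp add: ennreal_mult)
  have "enn_powr (ennreal (m * indicator (ball 0 r) x)) p = ennreal (m powr p) * indicator (ball 0 r) x" for x :: 'a
    using m by (auto simp: indicator_def enn_powr_ennreal)
  then have "Lp_norm p (\<lambda>x::'a. ennreal (m * indicator (ball 0 r) x)) =
      enn_powr (ennreal (m powr p * (r ^ DIM('a) * measure lborel (ball (0::'a) 1)))) (1 / p)"
    unfolding Lp_norm_def using m r
    by (simp only:) (simp add: nn_integral_cmult_indicator 1 ennreal_mult)
  also have "\<dots> = ennreal ((m powr p * (r powr real DIM('a) * measure lborel (ball (0::'a) 1))) powr (1 / p))"
    using r by (simp add: enn_powr_ennreal powr_realpow)
  also have "(m powr p * (r powr real DIM('a) * measure lborel (ball (0::'a) 1))) powr (1 / p) =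
      m * r powr (real DIM('a) / p) * measure lborel (ball (0::'a) 1) powr (1 / p)"
    using m r p by (simp add: powr_mult powr_powr)
  finally show ?thesis .
qed

lemma lq_norm_ge:
  assumes q: "0 < q" and i: "i \<in> I"
  shows "a i \<le> lq_norm q I a"
proof (cases "q = \<infinity>")
  case True
  then show ?thesis using i by (simp add: lq_norm_def SUP_upper)
next
  case False
  define s where "s = enn2real q"
  have s: "0 < s" using q False by (simp add: s_def enn2real_positive_iff less_top)
  have "enn_powr (a i) s = (\<Sum>\<^sub>\<infinity>j\<in>{i}. enn_powr (a j) s)" by simp
  also have "\<dots> \<le> (\<Sum>\<^sub>\<infinity>j\<in>I. enn_powr (a j) s)"
    using i by (intro infsum_mono_neutral nonneg_summable_on_complete) auto
  finally have "enn_powr (enn_powr (a i) s) (1 / s) \<le> enn_powr (\<Sum>\<^sub>\<infinity>j\<in>I. enn_powr (a j) s) (1 / s)"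
    using s by (intro enn_powr_mono) auto
  then show ?thesis using False s by (simp add: lq_norm_def enn_powr_powr_inverse s_def)
qed

text \<open>At most \<open>m\<close> terms of size at most \<open>A\<close> contribute. For
  \<open>q = \<infinity>\<close> the value of \<open>1 / q\<close> is 0 and the factor becomes 1, so
  one formula covers sums and the supremum.\<close>

lemma lq_norm_le_card:
  assumes q: "0 < q" and S: "finite S" "real (card S) \<le> m" and m: "1 \<le> m" and A: "0 \<le> A"
    and a: "\<And>i. i \<in> I \<Longrightarrow> i \<in> S \<Longrightarrow> a i \<le> ennreal A" and 0: "\<And>i. i \<in> I \<Longrightarrow> i \<notin> S \<Longrightarrow> a i = 0"
  shows "lq_norm q I a \<le> ennreal (m powr enn2real (1 / q) * A)"
proof (cases "q = \<infinity>")
  case True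
  have "(SUP i\<in>I. a i) \<le> ennreal A"
    by (intro SUP_least) (metis a 0 zero_le)
  then show ?thesis using True m by (simp add: lq_norm_def)
next
  case False
  define s where "s = enn2real q"
  have s: "0 < s" using q False by (simp add: s_def enn2real_positive_iff less_top)
  have "q = ennreal s" using False by (simp add: s_def less_top)
  \<comment> \<open>The definition of \<open>lq_norm\<close> takes the reciprocal in the reals, the
    statement takes it in \<open>ennreal\<close>; for finite positive \<open>q\<close> they
    agree.\<close>
  then have qs: "enn2real (1 / q) = 1 / s"
    using s by (metis divide_ennreal ennreal_1 enn2real_ennreal less_imp_le zero_le_divide_1_iff zero_le_one)
  have "(\<Sum>\<^sub>\<infinity>i\<in>I. enn_powr (a i) s) = (\<Sum>\<^sub>\<infinity>i\<in>I \<inter> S. enn_powr (a i) s)"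
    by (intro infsum_cong_neutral) (auto simp: 0)
  also have "\<dots> = (\<Sum>i\<in>I \<inter> S. enn_powr (a i) s)"
    using S by (intro infsum_finite) auto
  also have "\<dots> \<le> (\<Sum>i\<in>I \<inter> S. ennreal (A powr s))"
  proof (intro sum_mono)
    fix i assume "i \<in> I \<inter> S"
    then have "enn_powr (a i) s \<le> enn_powr (ennreal A) s" using a s by (intro enn_powr_mono) auto
    then show "enn_powr (a i) s \<le> ennreal (A powr s)" using A by (simp add: enn_powr_ennreal)
  qed
  also have "\<dots> = ennreal (real (card (I \<inter> S)) * A powr s)"
    by (simp add: ennreal_mult ennreal_of_nat_eq_real_of_nat)
  also have "\<dots> \<le> ennreal (m * A powr s)"
  proof (intro ennreal_leI mult_right_mono)
    have "card (I \<inter> S) \<le> card S" using S by (intro card_mono) auto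
    then show "real (card (I \<inter> S)) \<le> m" using S(2) by linarith
  qed simp
  finally have "lq_norm q I a \<le> enn_powr (ennreal (m * A powr s)) (1 / s)"
    using False s unfolding lq_norm_def by (auto simp: s_def intro!: enn_powr_mono)
  also have "\<dots> = ennreal (m powr enn2real (1 / q) * A)"
    using m A s by (simp add: enn_powr_ennreal qs powr_mult powr_powr)
  finally show ?thesis .
qed

section \<open>Dilations and supports on the frequency side\<close>

text \<open>When \<open>T\<close> is linear, \<open>\<zeta>\<close> is the image of
  \<open>\<eta>\<close> under the inverse transpose of \<open>T\<close>; the hypothesis on inner
  products says this without adjoints. Since the Jacobian \<open>c\<close> is built into the dilate,
  no constant remains.\<close>

lemma fourier_volume_scaling:
  assumes T: "volume_scaling T c" and [measurable]: "g \<in> borel_measurable borel"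
    and \<zeta>: "\<And>y. \<eta> \<bullet> y = \<zeta> \<bullet> T y"
  shows "fourier (\<lambda>y. of_real c * g (T y)) \<eta> = fourier g \<zeta>"
  using volume_scaling_integral[OF T, of "\<lambda>z. g z * unit_char (\<zeta> \<bullet> z)"]
  by (simp add: fourier_unit_char \<zeta> scaleR_conv_of_real mult.assoc)

lemma fourier_cmult: "fourier (\<lambda>y. a * g y) \<eta> = a * fourier g \<eta>"
  by (simp add: fourier_unit_char mult.assoc)

lemma borel_measurable_cnj [measurable]: "cnj \<in> borel_measurable borel"
  by (intro borel_measurable_continuous_onI continuous_intros)

lemma fourier_tilde:
  assumes [measurable]: "g \<in> borel_measurable borel"
  shows "fourier (tilde g) \<zeta> = cnj (fourier g \<zeta>)"
proof -
  have "volume_scaling (\<lambda>y::real^'a. - y) 1" using volume_scaling_diff[of "0::real^'a"] by simp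
  from volume_scaling_integral[OF this, of "\<lambda>x. cnj (g x) * unit_char (- (\<zeta> \<bullet> x))"]
  have "fourier (tilde g) \<zeta> = (\<integral>x. cnj (g x) * unit_char (- (\<zeta> \<bullet> x)) \<partial>lborel)"
    by (simp add: fourier_unit_char tilde_def)
  also have "\<dots> = (\<integral>x. cnj (g x * unit_char (\<zeta> \<bullet> x)) \<partial>lborel)"
    by (simp add: cnj_unit_char)
  also have "\<dots> = cnj (\<integral>x. g x * unit_char (\<zeta> \<bullet> x) \<partial>lborel)"
    by (rule Bochner_Integration.integral_cnj)
  finally show ?thesis by (simp only: fourier_unit_char)
qed

lemma rapidly_decreasing_tilde:
  assumes g: "rapidly_decreasing g" shows "rapidly_decreasing (tilde g)"
proof -
  have "rapidly_decreasing (\<lambda>x. 1 * g (- x))"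
    by (rule rapidly_decreasing_linear_image[OF g, of _ 1]) (auto intro: linear_uminus)
  then show ?thesis
    unfolding rapidly_decreasing_def tilde_def by (auto intro: continuous_intros)
qed

lemma supp_memI: "f x \<noteq> 0 \<Longrightarrow> x \<in> supp f"
  unfolding supp_def using closure_subset by fastforce

section \<open>Explicit inverses and determinants of the shearlet matrices\<close>

lemma matrix_inv_eqI:
  fixes A B :: "real^'n^'n"
  assumes "A ** B = mat 1" "B ** A = mat 1"
  shows "matrix_inv A = B"
proof -
  have "A ** matrix_inv A = mat 1 \<and> matrix_inv A ** A = mat 1"
    unfolding matrix_inv_def by (rule someI[of _ B]) (use assms in simp)
  then show ?thesis using assms
    by (metis matrix_mul_assoc matrix_mul_lid matrix_mul_rid)
qed

text \<open>This family is closed under multiplication and contains \<open>A_mat \<dd>\<close> as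
  \<open>diag_mat \<dd> 4 2\<close>, so powers and inverses of \<open>A_mat\<close> become
  computations with two scalars.\<close>

definition diag_mat :: "'d \<Rightarrow> real \<Rightarrow> real \<Rightarrow> real^'d^'d" where
  "diag_mat \<dd> a b = (\<chi> i k. if i = k then (if i = \<dd> then a else b) else 0)"

lemma diag_mat_vector: "diag_mat \<dd> a b *v x = (\<chi> k. (if k = \<dd> then a else b) * x $ k)"
  by (simp add: vec_eq_iff matrix_vector_mult_def diag_mat_def if_distrib[of "\<lambda>c. c * _"] cong: if_cong)

text \<open>The displacement is along the axis \<open>\<dd>\<close> and does not depend on that
  coordinate, which is the form required by \<open>volume_scaling_shear\<close>.\<close>

lemma B_mat_vector:
  "B_mat \<dd> l *v x = x + (\<Sum>k\<in>UNIV - {\<dd>}. of_int (l k) * x $ k) *\<^sub>R axis \<dd> 1"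
proof -
  have "(\<Sum>k\<in>UNIV. (if i = k then 1 else if i = \<dd> then real_of_int (l k) else 0) * x $ k) =
      x $ i + (if i = \<dd> then \<Sum>k\<in>UNIV - {\<dd>}. of_int (l k) * x $ k else 0)" for i
  proof -
    have "(\<Sum>k\<in>UNIV. (if i = k then 1 else if i = \<dd> then real_of_int (l k) else 0) * x $ k) =
        x $ i + (\<Sum>k\<in>UNIV - {i}. (if i = k then 1 else if i = \<dd> then real_of_int (l k) else 0) * x $ k)"
      by (subst sum.remove[of _ i]) auto
    also have "(\<Sum>k\<in>UNIV - {i}. (if i = k then 1 else if i = \<dd> then real_of_int (l k) else 0) * x $ k) =
        (\<Sum>k\<in>UNIV - {i}. (if i = \<dd> then real_of_int (l k) * x $ k else 0))"
      by (intro sum.cong) auto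
    finally show ?thesis by auto
  qed
  then show ?thesis
    by (simp add: vec_eq_iff matrix_vector_mult_def B_mat_def axis_def)
qed

lemma diag_mat_mult: "diag_mat \<dd> a b ** diag_mat \<dd> a' b' = diag_mat \<dd> (a * a') (b * b')"
  by (subst matrix_eq) (simp add: matrix_vector_mul_assoc[symmetric] diag_mat_vector vec_eq_iff)

lemma diag_mat_1: "diag_mat \<dd> 1 1 = mat 1"
  by (simp add: diag_mat_def mat_def cong: if_cong)

text \<open>Shears along the same axis add their parameters, so that negating the parameter inverts
  the matrix.\<close>

lemma B_mat_mult: "B_mat \<dd> l ** B_mat \<dd> m = B_mat \<dd> (\<lambda>k. l k + m k)"
  by (subst matrix_eq)
     (simp add: matrix_vector_mul_assoc[symmetric] B_mat_vector vec_eq_iff axis_def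
        algebra_simps sum.distrib cong: sum.cong_simp)

lemma B_mat_0: "B_mat \<dd> (\<lambda>_. 0) = mat 1"
  by (subst matrix_eq) (simp add: B_mat_vector)

lemma AB_mat_eq: "AB_mat \<dd> j l = diag_mat \<dd> (1 / 4 ^ j) (1 / 2 ^ j) ** B_mat \<dd> (\<lambda>k. - l k)"
proof -
  have "A_mat \<dd> = diag_mat \<dd> 4 2" by (simp add: A_mat_def diag_mat_def)
  then have "matrix_inv (A_mat \<dd>) = diag_mat \<dd> (1 / 4) (1 / 2)"
    by (auto intro!: matrix_inv_eqI simp: diag_mat_mult diag_mat_1)
  moreover have "mat_pow (diag_mat \<dd> a b) j = diag_mat \<dd> (a ^ j) (b ^ j)" for a b
    by (induction j) (simp_all add: diag_mat_mult diag_mat_1)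
  ultimately show ?thesis by (simp add: AB_mat_def power_one_over)
qed

lemma matrix_inv_AB_mat:
  shows AB_mat_right_inverse: "AB_mat \<dd> j l ** (B_mat \<dd> l ** diag_mat \<dd> (4 ^ j) (2 ^ j)) = mat 1"
    and "matrix_inv (AB_mat \<dd> j l) = B_mat \<dd> l ** diag_mat \<dd> (4 ^ j) (2 ^ j)"
proof -
  have B: "B_mat \<dd> (\<lambda>k. - l k) ** B_mat \<dd> l = mat 1" "B_mat \<dd> l ** B_mat \<dd> (\<lambda>k. - l k) = mat 1"
    by (simp_all add: B_mat_mult B_mat_0)
  have D: "diag_mat \<dd> (1 / 4 ^ j) (1 / 2 ^ j) ** diag_mat \<dd> (4 ^ j) (2 ^ j) = mat 1"
      "diag_mat \<dd> (4 ^ j) (2 ^ j) ** diag_mat \<dd> (1 / 4 ^ j) (1 / 2 ^ j) = mat 1"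
    by (simp_all add: diag_mat_mult diag_mat_1)
  show 1: "AB_mat \<dd> j l ** (B_mat \<dd> l ** diag_mat \<dd> (4 ^ j) (2 ^ j)) = mat 1"
    unfolding AB_mat_eq by (metis B(1) D(1) matrix_mul_assoc matrix_mul_rid)
  have 2: "(B_mat \<dd> l ** diag_mat \<dd> (4 ^ j) (2 ^ j)) ** AB_mat \<dd> j l = mat 1"
    unfolding AB_mat_eq by (metis B(2) D(2) matrix_mul_assoc matrix_mul_rid)
  show "matrix_inv (AB_mat \<dd> j l) = B_mat \<dd> l ** diag_mat \<dd> (4 ^ j) (2 ^ j)"
    using 1 2 by (rule matrix_inv_eqI)
qed

text \<open>Shears are unimodular because conjugating \<open>B\<^sup>[\<^sup>l\<^sup>]\<close> by a diagonal matrix yields its square.\<close>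

lemma det_B_mat: "det (B_mat \<dd> l) = 1"
proof -
  have "B_mat \<dd> l ** B_mat \<dd> (\<lambda>k. - l k) = mat 1"
    by (simp add: B_mat_mult B_mat_0)
  then have nz: "det (B_mat \<dd> l) \<noteq> 0"
    by (metis det_I det_mul mult_zero_left zero_neq_one)
  have "diag_mat \<dd> 2 1 ** B_mat \<dd> l = (B_mat \<dd> l ** B_mat \<dd> l) ** diag_mat \<dd> 2 1"
    by (subst matrix_eq)
       (simp add: matrix_vector_mul_assoc[symmetric] B_mat_mult diag_mat_vector B_mat_vector vec_eq_iff
          axis_def sum_distrib_left algebra_simps)
  then have "det (diag_mat \<dd> 2 1) * det (B_mat \<dd> l) = det (B_mat \<dd> l) * det (B_mat \<dd> l) * det (diag_mat \<dd> 2 1)"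
    by (metis det_mul)
  moreover have "det (diag_mat \<dd> 2 1) \<noteq> 0"
  proof -
    have "diag_mat \<dd> 2 1 ** diag_mat \<dd> (1 / 2) 1 = mat 1" by (simp add: diag_mat_mult diag_mat_1)
    then show ?thesis by (metis det_I det_mul mult_zero_left zero_neq_one)
  qed
  ultimately show ?thesis using nz by simp
qed

lemma det_diag_mat: "det (diag_mat \<dd> a b :: real^'d^'d) = a * b ^ (CARD('d) - 1)"
proof -
  have "det (diag_mat \<dd> a b) = (\<Prod>i\<in>UNIV. if i = \<dd> then a else b)"
    by (subst det_diagonal) (simp_all add: diag_mat_def)
  also have "\<dots> = a * (\<Prod>i\<in>UNIV - {\<dd>}. b)"
    by (subst prod.remove[of _ \<dd>]) (auto intro: prod.cong)
  finally show ?thesis by (simp add: card_Diff_singleton)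
qed

text \<open>The inverse matrix is a diagonal dilation followed by the shear
  \<open>B_mat \<dd> l\<close>. The shear preserves volume and the dilation contributes 4^j
  2^(j(d-1)), which is exactly the normalising factor in \<open>mat_dilate\<close>.\<close>

lemma volume_scaling_AB_mat:
  "volume_scaling (\<lambda>x. matrix_inv (AB_mat \<dd> j l) *v x) (inverse \<bar>det (AB_mat \<dd> j l :: real^'d^'d)\<bar>)"
proof -
  have "volume_scaling (\<lambda>x. B_mat \<dd> l *v x) 1"
    unfolding B_mat_vector
  proof (rule volume_scaling_shear)
    show "axis \<dd> 1 \<in> (Basis :: (real^'d) set)" by (simp add: axis_in_Basis_iff)
    show "(\<lambda>x::real^'d. \<Sum>k\<in>UNIV - {\<dd>}. of_int (l k) * x $ k) \<in> borel_measurable borel"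
      by (intro borel_measurable_continuous_onI continuous_intros)
    show "(\<Sum>k\<in>UNIV - {\<dd>}. of_int (l k) * (x + t *\<^sub>R axis \<dd> 1) $ k) = (\<Sum>k\<in>UNIV - {\<dd>}. of_int (l k) * x $ k)"
      for x :: "real^'d" and t
      by (intro sum.cong) (auto simp: axis_def)
  qed
  moreover have "volume_scaling (\<lambda>x. diag_mat \<dd> a b *v x) (a * b ^ (CARD('d) - 1))"
    if ab: "0 < a" "0 < b" for a b
  proof -
    define c where "c = (\<lambda>e::real^'d. if e = axis \<dd> 1 then a else b)"
    have B: "(Basis :: (real^'d) set) = (\<lambda>k. axis k 1) ` UNIV" by (auto simp: Basis_vec_def)
    have inj: "inj (\<lambda>k::'d. axis k (1::real))" by (auto simp: inj_def axis_eq_axis)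
    have "(\<Prod>e\<in>Basis. c e) = (\<Prod>k\<in>UNIV. if k = \<dd> then a else b)"
      unfolding B by (subst prod.reindex[OF inj]) (auto simp: c_def axis_eq_axis intro: prod.cong)
    also have "\<dots> = a * (\<Prod>i\<in>UNIV - {\<dd>}. b)"
      by (subst prod.remove[of _ \<dd>]) (auto intro: prod.cong)
    also have "\<dots> = a * b ^ (CARD('d) - 1)" by (simp add: card_Diff_singleton)
    finally have "volume_scaling (\<lambda>x. \<Sum>e\<in>Basis. (c e * (x \<bullet> e)) *\<^sub>R e) (a * b ^ (CARD('d) - 1))"
      using volume_scaling_diagonal[of c] ab by (simp add: c_def)
    moreover have "(\<Sum>e\<in>Basis. (c e * (x \<bullet> e)) *\<^sub>R e) = diag_mat \<dd> a b *v x" for x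
    proof -
      have "(\<Sum>e\<in>Basis. (c e * (x \<bullet> e)) *\<^sub>R e) = (\<Sum>k\<in>UNIV. ((if k = \<dd> then a else b) * x $ k) *\<^sub>R axis k 1)"
        unfolding B by (subst sum.reindex[OF inj]) (auto simp: c_def axis_eq_axis inner_axis intro: sum.cong)
      also have "\<dots> = diag_mat \<dd> a b *v x"
        by (simp add: vec_eq_iff diag_mat_vector axis_def if_distrib[of "\<lambda>u. _ * u"] cong: if_cong)
      finally show ?thesis .
    qed
    ultimately show ?thesis by simp
  qed
  then have "volume_scaling (\<lambda>x. diag_mat \<dd> (4 ^ j) (2 ^ j) *v x) (4 ^ j * (2 ^ j) ^ (CARD('d) - 1))"
    by simp
  ultimately have "volume_scaling (\<lambda>x. B_mat \<dd> l *v (diag_mat \<dd> (4 ^ j) (2 ^ j) *v x)) (1 * (4 ^ j * (2 ^ j) ^ (CARD('d) - 1)))"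
    by (rule volume_scaling_compose)
  moreover have "inverse \<bar>det (AB_mat \<dd> j l :: real^'d^'d)\<bar> = 4 ^ j * (2 ^ j) ^ (CARD('d) - 1)"
    by (simp add: AB_mat_eq det_mul det_B_mat det_diag_mat abs_mult power_one_over field_simps)
  ultimately show ?thesis
    by (simp add: matrix_inv_AB_mat matrix_vector_mul_assoc)
qed

text \<open>In row \<open>\<dd>\<close> of A^-j B^[-l] the shear entries, of size at most 2^j, are
  divided by 4^j; the other rows carry 1 / 2^j. So all entries are at most 2^-j uniformly in
  \<open>l\<close>: the range of the shears is balanced against the parabolic scaling. One factor d
  comes from summing a row, the other from bounding the Euclidean norm by the sum of the
  components.\<close>

lemma norm_le_AB_mat:
  fixes y :: "real^'d"
  assumes l: "l \<in> shears \<dd> j"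
  shows "2 ^ j * norm y \<le> (real CARD('d))\<^sup>2 * norm (matrix_inv (AB_mat \<dd> j l) *v y)"
proof -
  define z where "z = matrix_inv (AB_mat \<dd> j l) *v y"
  have y: "y = AB_mat \<dd> j l *v z"
    unfolding z_def matrix_inv_AB_mat(2) by (simp add: matrix_vector_mul_assoc AB_mat_right_inverse)
  have "\<bar>y $ k\<bar> \<le> real CARD('d) * norm z / 2 ^ j" for k
  proof (cases "k = \<dd>")
    case True
    have "\<bar>of_int (l i) * z $ i\<bar> \<le> 2 ^ j * norm z" for i
    proof -
      have "\<bar>real_of_int (l i)\<bar> \<le> 2 ^ j"
        using l by (simp add: shears_def flip: of_int_abs)
      then show ?thesis unfolding abs_mult by (intro mult_mono component_le_norm_cart) auto
    qed
    then have "\<bar>\<Sum>i\<in>UNIV - {\<dd>}. of_int (l i) * z $ i\<bar> \<le> (\<Sum>i\<in>UNIV - {\<dd>}. 2 ^ j * norm z)"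
      by (intro order_trans[OF sum_abs] sum_mono)
    also have "\<dots> = real (CARD('d) - 1) * (2 ^ j * norm z)" by (simp add: card_Diff_singleton)
    finally have 1: "\<bar>\<Sum>i\<in>UNIV - {\<dd>}. of_int (l i) * z $ i\<bar> \<le> real (CARD('d) - 1) * (2 ^ j * norm z)" .
    have "\<bar>z $ \<dd>\<bar> \<le> 1 * norm z" using component_le_norm_cart by simp
    also have "\<dots> \<le> 2 ^ j * norm z" by (intro mult_right_mono) auto
    finally have "\<bar>z $ \<dd> - (\<Sum>i\<in>UNIV - {\<dd>}. of_int (l i) * z $ i)\<bar> \<le> 2 ^ j * norm z + real (CARD('d) - 1) * (2 ^ j * norm z)"
      using 1 by linarith
    also have "\<dots> = real CARD('d) * (2 ^ j * norm z)"
      by (simp add: of_nat_diff Suc_leI algebra_simps)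
    finally have 2: "\<bar>z $ \<dd> - (\<Sum>i\<in>UNIV - {\<dd>}. of_int (l i) * z $ i)\<bar> \<le> real CARD('d) * (2 ^ j * norm z)" .
    have "4 ^ j = (2 ^ j * 2 ^ j :: real)" by (simp flip: power_mult_distrib)
    moreover have "y $ k = (z $ \<dd> - (\<Sum>i\<in>UNIV - {\<dd>}. of_int (l i) * z $ i)) / 4 ^ j"
      unfolding y AB_mat_eq
      by (simp add: True matrix_vector_mul_assoc[symmetric] diag_mat_vector B_mat_vector sum_negf)
    ultimately have "\<bar>y $ k\<bar> = \<bar>z $ \<dd> - (\<Sum>i\<in>UNIV - {\<dd>}. of_int (l i) * z $ i)\<bar> / (2 ^ j * 2 ^ j)"
      by (simp add: abs_divide)
    also have "\<dots> \<le> real CARD('d) * (2 ^ j * norm z) / (2 ^ j * 2 ^ j)"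
      by (intro divide_right_mono 2) simp
    finally show ?thesis by simp
  next
    case False
    have "y $ k = z $ k / 2 ^ j"
      unfolding y AB_mat_eq
      using False by (simp add: matrix_vector_mul_assoc[symmetric] diag_mat_vector B_mat_vector axis_def)
    moreover have "\<bar>z $ k\<bar> \<le> real CARD('d) * norm z"
      using component_le_norm_cart[of z k] mult_right_mono[of 1 "real CARD('d)" "norm z"] by (simp add: Suc_leI)
    ultimately show ?thesis by (simp add: abs_divide divide_right_mono)
  qed
  then have "norm y \<le> (\<Sum>k\<in>(UNIV::'d set). real CARD('d) * norm z / 2 ^ j)"
    by (intro order_trans[OF norm_le_l1_cart] sum_mono)
  then show ?thesis by (simp add: z_def[symmetric] power2_eq_square field_simps)
qed

section \<open>Frequency localisation of shearlets\<close>

lemma psi_hat_support: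
  assumes \<psi>1: "supp \<psi>1h \<subseteq> {-1/2..-1/16} \<union> {1/16..1/2}" and \<psi>2: "supp \<psi>2h \<subseteq> {-1..1}"
    and nz: "psi_hat \<psi>1h \<psi>2h \<dd> \<zeta> \<noteq> 0"
  shows "1 / 16 \<le> \<bar>\<zeta> $ \<dd>\<bar>" "\<bar>\<zeta> $ i\<bar> \<le> 1 / 2"
proof -
  have "\<psi>1h (\<zeta> $ \<dd>) \<noteq> 0" and 2: "i \<noteq> \<dd> \<Longrightarrow> \<psi>2h (\<zeta> $ i / \<zeta> $ \<dd>) \<noteq> 0" for i
    using nz by (auto simp: psi_hat_def)
  then have d: "1 / 16 \<le> \<bar>\<zeta> $ \<dd>\<bar>" "\<bar>\<zeta> $ \<dd>\<bar> \<le> 1 / 2"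
    using supp_memI[of \<psi>1h "\<zeta> $ \<dd>"] \<psi>1 by auto
  then show "1 / 16 \<le> \<bar>\<zeta> $ \<dd>\<bar>" by simp
  show "\<bar>\<zeta> $ i\<bar> \<le> 1 / 2"
  proof (cases "i = \<dd>")
    case False
    have "\<zeta> $ i / \<zeta> $ \<dd> \<in> {-1..1}"
      using supp_memI[of \<psi>2h, OF 2[OF False]] \<psi>2 by blast
    then have "\<bar>\<zeta> $ i / \<zeta> $ \<dd>\<bar> \<le> 1" by (meson abs_le_iff atLeastAtMost_iff minus_le_iff)
    then have "\<bar>\<zeta> $ i\<bar> \<le> \<bar>\<zeta> $ \<dd>\<bar>" using d by (simp add: abs_divide field_simps)
    then show ?thesis using d by simp
  qed (use d in simp)
qed

text \<open>The frequencies are the row vectors \<open>\<zeta>\<close> B^[l] A^j with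
  \<open>\<zeta>\<close> in the support of \<open>psi_hat\<close>. Coordinate \<open>\<dd>\<close>
  is 4^j times that of \<open>\<zeta>\<close>, which gives the lower bound; in the other coordinates
  a shear of size at most 2^j is followed by a dilation by 2^j, which never exceeds 4^j. The
  resulting shell is therefore the same for all shears of one scale.\<close>

lemma fourier_shearlet_support:
  fixes g :: "real^'d \<Rightarrow> complex"
  assumes [measurable]: "g \<in> borel_measurable borel"
    and ft: "fourier g = psi_hat \<psi>1h \<psi>2h \<dd>"
    and \<psi>1: "supp \<psi>1h \<subseteq> {-1/2..-1/16} \<union> {1/16..1/2}" and \<psi>2: "supp \<psi>2h \<subseteq> {-1..1}"
    and l: "l \<in> shears \<dd> j"
    and nz: "fourier (mat_dilate (AB_mat \<dd> j l) (tilde g)) \<eta> \<noteq> 0"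
  shows "4 ^ j / 16 \<le> norm \<eta>" "norm \<eta> \<le> real CARD('d) * 4 ^ j"
proof -
  define \<zeta> where "\<zeta> = \<eta> v* AB_mat \<dd> j l"
  have [measurable]: "tilde g \<in> borel_measurable borel"
    unfolding tilde_def[abs_def] by measurable
  have inner: "\<eta> \<bullet> y = \<zeta> \<bullet> (matrix_inv (AB_mat \<dd> j l) *v y)" for y
    unfolding \<zeta>_def dot_lmul_matrix matrix_vector_mul_assoc matrix_inv_AB_mat(2) AB_mat_right_inverse
    by simp
  have "fourier (mat_dilate (AB_mat \<dd> j l) (tilde g)) \<eta> = cnj (fourier g \<zeta>)"
    unfolding mat_dilate_def
    by (subst fourier_volume_scaling[OF volume_scaling_AB_mat _ inner]) (simp_all add: fourier_tilde)
  then have "psi_hat \<psi>1h \<psi>2h \<dd> \<zeta> \<noteq> 0" using nz ft by auto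
  note \<zeta> = psi_hat_support[OF \<psi>1 \<psi>2 this]
  \<comment> \<open>The coordinates of \<open>\<eta>\<close> are read off by testing the identity
    \<open>inner\<close> on the basis vectors.\<close>
  have comp: "\<eta> $ k = (if k = \<dd> then 4 ^ j * \<zeta> $ \<dd> else 2 ^ j * (\<zeta> $ k + of_int (l k) * \<zeta> $ \<dd>))" for k
  proof -
    define t :: real where "t = (if k = \<dd> then 4 ^ j else 2 ^ j)"
    have "diag_mat \<dd> (4 ^ j) (2 ^ j) *v axis k 1 = t *\<^sub>R axis k 1"
      by (auto simp: diag_mat_vector vec_eq_iff axis_def t_def)
    moreover have "(\<Sum>i\<in>UNIV - {\<dd>}. of_int (l i) * (t *\<^sub>R axis k 1) $ i) = (if k = \<dd> then 0 else of_int (l k) * t)"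
    proof -
      have "(\<Sum>i\<in>UNIV - {\<dd>}. of_int (l i) * (t *\<^sub>R axis k 1) $ i) = (\<Sum>i\<in>UNIV - {\<dd>}. if i = k then of_int (l k) * t else 0)"
        by (intro sum.cong) (auto simp: axis_def)
      then show ?thesis by simp
    qed
    ultimately have "matrix_inv (AB_mat \<dd> j l) *v axis k 1 =
        t *\<^sub>R axis k 1 + (if k = \<dd> then 0 else of_int (l k) * t) *\<^sub>R axis \<dd> 1"
      by (simp add: matrix_inv_AB_mat(2) matrix_vector_mul_assoc[symmetric] B_mat_vector del: vector_scaleR_component)
    then have "\<eta> \<bullet> axis k 1 = \<zeta> \<bullet> (t *\<^sub>R axis k 1 + (if k = \<dd> then 0 else of_int (l k) * t) *\<^sub>R axis \<dd> 1)"
      using inner[of "axis k 1"] by simp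
    then show ?thesis
      by (auto simp: inner_axis inner_add_right t_def algebra_simps)
  qed
  have "4 ^ j / 16 \<le> \<bar>\<eta> $ \<dd>\<bar>" using \<zeta>(1) by (simp add: comp abs_mult)
  also have "\<dots> \<le> norm \<eta>" by (rule component_le_norm_cart)
  finally show "4 ^ j / 16 \<le> norm \<eta>" .
  have "\<bar>\<eta> $ k\<bar> \<le> 4 ^ j" for k
  proof (cases "k = \<dd>")
    case True
    then have "\<bar>\<eta> $ k\<bar> = 4 ^ j * \<bar>\<zeta> $ \<dd>\<bar>" by (simp add: comp abs_mult)
    also have "\<dots> \<le> 4 ^ j * 1" using \<zeta>(2)[of \<dd>] by (intro mult_left_mono) auto
    finally show ?thesis by simp
  next
    case False
    have "\<bar>real_of_int (l k)\<bar> \<le> 2 ^ j"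
      using l by (simp add: shears_def flip: of_int_abs)
    then have "\<bar>of_int (l k) * \<zeta> $ \<dd>\<bar> \<le> 2 ^ j * (1 / 2)"
      unfolding abs_mult by (intro mult_mono \<zeta>(2)) auto
    moreover have "\<bar>\<zeta> $ k\<bar> \<le> 2 ^ j * (1 / 2)"
      using \<zeta>(2)[of k] by (rule order_trans) simp
    ultimately have "\<bar>\<zeta> $ k + of_int (l k) * \<zeta> $ \<dd>\<bar> \<le> 2 ^ j" by linarith
    then have "2 ^ j * \<bar>\<zeta> $ k + of_int (l k) * \<zeta> $ \<dd>\<bar> \<le> 2 ^ j * 2 ^ j" by (intro mult_left_mono) auto
    also have "2 ^ j * 2 ^ j = (4 ^ j :: real)" by (simp flip: power_mult_distrib)
    finally show ?thesis using False by (simp add: comp abs_mult)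
  qed
  then have "norm \<eta> \<le> (\<Sum>k\<in>(UNIV::'d set). 4 ^ j)"
    by (intro order_trans[OF norm_le_l1_cart] sum_mono)
  then show "norm \<eta> \<le> real CARD('d) * 4 ^ j" by simp
qed

section \<open>Number of shears in a range of scales\<close>

lemma
  fixes \<dd> :: "'d::finite"
  shows finite_shears: "finite (shears \<dd> j)"
    and card_shears_le: "card (shears \<dd> j) \<le> (2 * 2 ^ j + 1) ^ (CARD('d) - 1)"
proof -
  let ?P = "PiE (UNIV - {\<dd>}) (\<lambda>_. {- (2 ^ j)..2 ^ j :: int})"
  have fin: "finite ?P" by (intro finite_PiE) auto
  \<comment> \<open>Restricting to the coordinates other than \<open>\<dd>\<close> loses nothing
    because every shear parameter is 0 at \<open>\<dd>\<close>; this is the origin of the exponent d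
    - 1.\<close>
  have inj: "inj_on (\<lambda>l. restrict l (UNIV - {\<dd>})) (shears \<dd> j)"
  proof (rule inj_onI, rule ext)
    fix l m k assume "l \<in> shears \<dd> j" "m \<in> shears \<dd> j" "restrict l (UNIV - {\<dd>}) = restrict m (UNIV - {\<dd>})"
    then show "l k = m k"
      by (cases "k = \<dd>") (auto simp: shears_def dest: fun_cong[of _ _ k])
  qed
  have sub: "(\<lambda>l. restrict l (UNIV - {\<dd>})) ` shears \<dd> j \<subseteq> ?P"
    by (auto simp: shears_def abs_le_iff PiE_def Pi_def minus_le_iff)
  show "finite (shears \<dd> j)" using inj sub fin by (metis finite_imageD finite_subset)
  have "card (shears \<dd> j) \<le> card ?P" using inj sub fin by (rule card_inj_on_le)
  also have "card ?P = card {- (2 ^ j)..2 ^ j :: int} ^ (CARD('d) - 1)"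
    by (simp add: card_PiE card_Diff_singleton)
  also have "card {- (2 ^ j)..2 ^ j :: int} = 2 * 2 ^ j + 1"
    by (simp add: nat_add_distrib nat_mult_distrib nat_power_eq)
  finally show "card (shears \<dd> j) \<le> (2 * 2 ^ j + 1) ^ (CARD('d) - 1)" .
qed

definition shear_band :: "nat \<Rightarrow> nat \<Rightarrow> ('d \<times> nat \<times> ('d \<Rightarrow> int)) set" where
  "shear_band a b = {(\<dd>, j, l). a \<le> j \<and> j \<le> b \<and> l \<in> shears \<dd> j}"

lemma
  shows finite_shear_band: "finite (shear_band a b :: ('d::finite \<times> nat \<times> ('d \<Rightarrow> int)) set)"
    and card_shear_band_le: "card (shear_band a b :: ('d \<times> nat \<times> ('d \<Rightarrow> int)) set) \<le>
           CARD('d) * (Suc b - a) * (2 * 2 ^ b + 1) ^ (CARD('d) - 1)"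
proof -
  have eq: "(shear_band a b :: ('d \<times> nat \<times> ('d \<Rightarrow> int)) set) =
      (SIGMA \<dd>:UNIV. SIGMA j:{a..b}. shears \<dd> j)"
    by (auto simp: shear_band_def)
  show "finite (shear_band a b :: ('d \<times> nat \<times> ('d \<Rightarrow> int)) set)"
    unfolding eq by (intro finite_SigmaI) (auto simp: finite_shears)
  have "card (SIGMA j:{a..b}. shears \<dd> j) \<le> (Suc b - a) * (2 * 2 ^ b + 1) ^ (CARD('d) - 1)" for \<dd> :: 'd
  proof -
    have "card (SIGMA j:{a..b}. shears \<dd> j) = (\<Sum>j\<in>{a..b}. card (shears \<dd> j))"
      by (simp add: finite_shears)
    also have "\<dots> \<le> (\<Sum>j\<in>{a..b}. (2 * 2 ^ b + 1) ^ (CARD('d) - 1))"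
      by (intro sum_mono order_trans[OF card_shears_le] power_mono) auto
    finally show ?thesis by simp
  qed
  moreover have "card (shear_band a b :: ('d \<times> nat \<times> ('d \<Rightarrow> int)) set) =
      (\<Sum>\<dd>\<in>(UNIV::'d set). card (SIGMA j:{a..b}. shears \<dd> j))"
    unfolding eq by (intro card_SigmaI) (auto simp: finite_shears)
  ultimately have "card (shear_band a b :: ('d \<times> nat \<times> ('d \<Rightarrow> int)) set) \<le>
      (\<Sum>\<dd>\<in>(UNIV::'d set). (Suc b - a) * (2 * 2 ^ b + 1) ^ (CARD('d) - 1))"
    by (simp only: sum_mono)
  then show "card (shear_band a b :: ('d \<times> nat \<times> ('d \<Rightarrow> int)) set) \<le>
      CARD('d) * (Suc b - a) * (2 * 2 ^ b + 1) ^ (CARD('d) - 1)"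
    by (simp add: mult.assoc)
qed

section \<open>The test functions\<close>

text \<open>The amplitude is 4^(n s). For \<open>s = d / p - \<alpha>\<close> it is balanced against
  the weight 4^(n \<alpha>) of band 2n and the factor 4^(-n d / p) from the L^p norm. The parameter
  stays free here because the shearlet estimate holds for every amplitude.\<close>

definition test_function :: "(real^'d \<Rightarrow> complex) \<Rightarrow> real \<Rightarrow> nat \<Rightarrow> real^'d \<Rightarrow> complex" where
  "test_function \<phi> s n y = of_real (2 powr (2 * real n * s)) * tilde \<phi> (4 ^ n *\<^sub>R y)"

lemma rapidly_decreasing_scaleR:
  assumes "rapidly_decreasing g" "0 < r"
  shows "rapidly_decreasing (\<lambda>y. a * g (r *\<^sub>R y))"
  using assms by (intro rapidly_decreasing_linear_image[of g _ "1 / r"]) (auto intro: linear_scaleR)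

lemma rapidly_decreasing_test_function:
  "rapidly_decreasing \<phi> \<Longrightarrow> rapidly_decreasing (test_function \<phi> s n)"
  unfolding test_function_def[abs_def]
  by (intro rapidly_decreasing_scaleR rapidly_decreasing_tilde) auto

lemma fourier_test_function_support:
  fixes \<phi> :: "real^'d \<Rightarrow> complex"
  assumes \<phi>: "rapidly_decreasing \<phi>" and supp: "supp (fourier \<phi>) \<subseteq> {\<xi>. 1/2 \<le> norm \<xi> \<and> norm \<xi> \<le> 2}"
    and nz: "fourier (test_function \<phi> s n) \<eta> \<noteq> 0"
  shows "4 ^ n / 2 \<le> norm \<eta>" "norm \<eta> \<le> 2 * 4 ^ n"
proof -
  define R :: real where "R = 4 ^ n"
  have R: "0 < R" by (simp add: R_def)
  have S: "volume_scaling (\<lambda>y::real^'d. R *\<^sub>R y) (R ^ DIM(real^'d))" using R by (rule volume_scaling_scaleR)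
  define a where "a = complex_of_real (2 powr (2 * real n * s) / R ^ DIM(real^'d))"
  have "test_function \<phi> s n = (\<lambda>y. a * (of_real (R ^ DIM(real^'d)) * tilde \<phi> (R *\<^sub>R y)))"
    using R by (simp add: fun_eq_iff test_function_def a_def flip: R_def)
  moreover have "fourier (\<lambda>y. of_real (R ^ DIM(real^'d)) * tilde \<phi> (R *\<^sub>R y)) \<eta> = fourier (tilde \<phi>) ((1 / R) *\<^sub>R \<eta>)"
    using R by (intro fourier_volume_scaling[OF S])
      (auto intro: rapidly_decreasing_measurable rapidly_decreasing_tilde \<phi>)
  ultimately have "fourier (test_function \<phi> s n) \<eta> = a * cnj (fourier \<phi> ((1 / R) *\<^sub>R \<eta>))"
    by (simp add: fourier_cmult fourier_tilde rapidly_decreasing_measurable[OF \<phi>])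
  then have "(1 / R) *\<^sub>R \<eta> \<in> supp (fourier \<phi>)" using nz by (intro supp_memI) auto
  then have "1 / 2 \<le> norm \<eta> / R" "norm \<eta> / R \<le> 2" using supp R by auto
  then show "4 ^ n / 2 \<le> norm \<eta>" "norm \<eta> \<le> 2 * 4 ^ n"
    using R by (auto simp: field_simps R_def)
qed

lemma conv_test_function_eq_0:
  assumes "rapidly_decreasing \<phi>" "supp (fourier \<phi>) \<subseteq> {\<xi>. 1/2 \<le> norm \<xi> \<and> norm \<xi> \<le> 2}"
    and g: "rapidly_decreasing g"
    and "\<And>\<xi>. 4 ^ n / 2 \<le> norm \<xi> \<Longrightarrow> norm \<xi> \<le> 2 * 4 ^ n \<Longrightarrow> fourier g \<xi> = 0"
  shows "conv g (distr_of (test_function \<phi> s n)) x = 0"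
proof -
  obtain B where "\<And>x. norm (g x) \<le> B" using rapidly_decreasing_bounded[OF g] by blast
  moreover have "continuous_on UNIV g" using g by (simp add: rapidly_decreasing_def)
  moreover have "fourier (test_function \<phi> s n) \<xi> = 0 \<or> fourier g \<xi> = 0" for \<xi>
    using fourier_test_function_support[OF assms(1,2)] assms(4) by blast
  ultimately show ?thesis
    using assms by (intro conv_eq_0_if_fourier_disjoint[where B=B] integrable_rapidly_decreasing
        rapidly_decreasing_test_function) auto
qed

lemma test_function_decay:
  assumes "rapidly_decreasing \<phi>"
  obtains D where "0 \<le> D"
    "\<And>s n y. norm (test_function \<phi> s n y) \<le> (2 powr (2 * real n * s) * D) / (1 + 4 ^ n * norm y) ^ N"
proof -
  obtain D where D: "0 \<le> D" "\<And>x. norm (tilde \<phi> x) \<le> D / (1 + norm x) ^ N"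
    using rapidly_decreasing_decay[OF rapidly_decreasing_tilde[OF assms]] by blast
  have "norm (test_function \<phi> s n y) \<le> (2 powr (2 * real n * s) * D) / (1 + 4 ^ n * norm y) ^ N" for s n y
  proof -
    have "norm (test_function \<phi> s n y) = 2 powr (2 * real n * s) * norm (tilde \<phi> (4 ^ n *\<^sub>R y))"
      by (simp add: test_function_def norm_mult)
    also have "\<dots> \<le> 2 powr (2 * real n * s) * (D / (1 + norm (4 ^ n *\<^sub>R y)) ^ N)"
      by (intro mult_left_mono D) simp
    finally show ?thesis by simp
  qed
  then show ?thesis using that D(1) by blast
qed

lemma dyadic_dilate_eq:
  "dyadic_dilate \<nu> g = (\<lambda>y::real^'d. of_real ((2 ^ \<nu>) ^ DIM(real^'d)) * g (2 ^ \<nu> *\<^sub>R y))"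
  by (simp add: fun_eq_iff dyadic_dilate_def power_mult[symmetric] mult.commute)

lemma four_power_eq_powr: "(4::real) ^ n = 2 powr (2 * real n)"
  by (simp add: powr_powr[symmetric] powr_realpow)

section \<open>Two-sided bounds for the classical norm\<close>

lemma F_norm_test_function_le:
  fixes \<phi> \<Phi> :: "real^'d \<Rightarrow> complex"
  assumes gen: "dyadic_generators \<phi> \<Phi>" and q: "0 < q" and p: "0 < p"
  obtains C where "0 < C"
    "\<And>n. 2 \<le> n \<Longrightarrow> F_norm \<phi> \<Phi> \<alpha> q p (distr_of (test_function \<phi> (real CARD('d) / p - \<alpha>) n)) \<le> ennreal C"
proof -
  define s where "s = real CARD('d) / p - \<alpha>"
  have \<phi>: "rapidly_decreasing \<phi>" and \<Phi>: "rapidly_decreasing \<Phi>"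
    using gen by (auto simp: dyadic_generators_def intro: rapidly_decreasing_schwartz)
  have supp: "supp (fourier \<phi>) \<subseteq> {\<xi>. 1/2 \<le> norm \<xi> \<and> norm \<xi> \<le> 2}"
    and supp': "supp (fourier \<Phi>) \<subseteq> {\<xi>. norm \<xi> \<le> 2}"
    using gen by (auto simp: dyadic_generators_def)
  obtain N :: nat where "2 * real DIM(real^'d) / p \<le> real N" using real_arch_simple by blast
  then have N: "2 * real DIM(real^'d) \<le> real N * p" using p by (simp add: field_simps)
  obtain D where D: "0 \<le> D"
    "\<And>s n y. norm (test_function \<phi> s n y) \<le> (2 powr (2 * real n * s) * D) / (1 + 4 ^ n * norm y) ^ N"
    using test_function_decay[OF \<phi>] by metis
  define A where "A = (\<integral>z. norm (\<phi> z) * (1 + norm z) ^ N \<partial>lborel)"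
  have A: "0 \<le> A" by (simp add: A_def)
  define J where "J = (\<integral>x. (1 + norm (x::real^'d)) powr (- (real N * p)) \<partial>lborel) powr (1 / p)"
  \<comment> \<open>The factors come from the five bands, from the drift of the weight over |\<nu> -
    2 n| \<le> 2, and from \<open>norm_conv_decay\<close> with 4 and 1 for its constants
    \<open>K\<close> and \<open>K'\<close>.\<close>
  define E where "E = 5 powr enn2real (1 / q) * (2 powr (2 * \<bar>\<alpha>\<bar>) * (D * ((1 + 4) * (1 + 1)) ^ N * A))"
  have E: "0 \<le> E" using D A by (simp add: E_def)
  \<comment> \<open>The summand 1 makes the constant strictly positive in every case.\<close>
  have bound: "F_norm \<phi> \<Phi> \<alpha> q p (distr_of (test_function \<phi> s n)) \<le> ennreal (E * J + 1)" if n: "2 \<le> n" for n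
  proof -
    define c where "c = 2 powr (2 * real n * s)"
    define u where "u = distr_of (test_function \<phi> s n)"
    \<comment> \<open>For n \<ge> 2 the annulus begins at 4^n / 2 \<ge> 8, beyond the radius 2 that
      contains the support of \<open>fourier \<Phi>\<close>.\<close>
    have "(4::real) ^ 2 \<le> 4 ^ n" using n by (intro power_increasing) auto
    then have "fourier \<Phi> \<xi> = 0" if "4 ^ n / 2 \<le> norm \<xi>" for \<xi>
      using supp_memI[of "fourier \<Phi>" \<xi>] supp' that by force
    then have "conv \<Phi> u x = 0" for x
      unfolding u_def by (intro conv_test_function_eq_0 \<phi> \<Phi> supp)
    then have 1: "Lp_norm p (\<lambda>x. ennreal (norm (conv \<Phi> u x))) = 0"
      using p by (simp add: Lp_norm_eq_0)
    have rd: "rapidly_decreasing (dyadic_dilate \<nu> \<phi>)" for \<nu>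
      unfolding dyadic_dilate_eq by (intro rapidly_decreasing_scaleR \<phi>) simp
    have S: "volume_scaling (\<lambda>y::real^'d. 2 ^ \<nu> *\<^sub>R y) ((2 ^ \<nu>) ^ DIM(real^'d))" for \<nu>
      by (rule volume_scaling_scaleR) simp
    \<comment> \<open>The shell from 2^\<nu> / 2 to 2 * 2^\<nu> meets the one from 4^n / 2 to 2 *
      4^n only if |\<nu> - 2 n| \<le> 2.\<close>
    have zero: "conv (dyadic_dilate \<nu> \<phi>) u x = 0" if \<nu>: "\<nu> \<notin> {2 * n - 2..2 * n + 2}" for \<nu> x
    proof -
      have "fourier (dyadic_dilate \<nu> \<phi>) \<xi> = 0" if \<xi>: "4 ^ n / 2 \<le> norm \<xi>" "norm \<xi> \<le> 2 * 4 ^ n" for \<xi>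
      proof (rule ccontr)
        assume nz: "fourier (dyadic_dilate \<nu> \<phi>) \<xi> \<noteq> 0"
        have "fourier (dyadic_dilate \<nu> \<phi>) \<xi> = fourier \<phi> ((1 / 2 ^ \<nu>) *\<^sub>R \<xi>)"
          unfolding dyadic_dilate_eq
          by (intro fourier_volume_scaling[OF S]) (auto intro: rapidly_decreasing_measurable \<phi>)
        with nz have "(1 / 2 ^ \<nu>) *\<^sub>R \<xi> \<in> supp (fourier \<phi>)" by (intro supp_memI) simp
        then have "1 / 2 \<le> norm \<xi> / 2 ^ \<nu>" "norm \<xi> / 2 ^ \<nu> \<le> 2" using supp by auto
        then have *: "2 ^ \<nu> / 2 \<le> norm \<xi>" "norm \<xi> \<le> 2 * 2 ^ \<nu>" by (auto simp: field_simps)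
        have four: "(4::real) ^ n = 2 ^ (2 * n)" by (simp add: power_mult)
        have "(2::real) ^ (2 * n) \<le> 2 ^ (\<nu> + 2)" "(2::real) ^ \<nu> \<le> 2 ^ (2 * n + 2)"
          using * \<xi> unfolding four by (auto simp: power_add)
        then have "2 * n \<le> \<nu> + 2" "\<nu> \<le> 2 * n + 2"
          by (auto dest!: power_le_imp_le_exp[rotated] simp del: power_Suc)
        then show False using \<nu> by auto
      qed
      then show ?thesis unfolding u_def by (intro conv_test_function_eq_0 \<phi> supp rd)
    qed
    define B where "B = 2 powr (2 * \<bar>\<alpha>\<bar>) * 2 powr (2 * real n * \<alpha>) * (c * D * ((1 + 4) * (1 + 1)) ^ N * A)"
    have B: "0 \<le> B" using D A by (simp add: B_def c_def)
    have band: "2 powr (real \<nu> * \<alpha>) * norm (conv (dyadic_dilate \<nu> \<phi>) u x) \<le> B / (1 + 4 ^ n * norm x) ^ N"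
      if \<nu>: "\<nu> \<in> {2 * n - 2..2 * n + 2}" for \<nu> x
    proof -
      have "(2::real) ^ (2 * n) \<le> 2 ^ (\<nu> + 2)" using \<nu> by (intro power_increasing) auto
      then have "(4::real) ^ n \<le> 4 * 2 ^ \<nu>" by (simp add: power_mult power_add)
      then have "4 ^ n * norm y \<le> 4 * norm (2 ^ \<nu> *\<^sub>R y)" for y :: "real^'d"
        using mult_right_mono[of "4 ^ n" "4 * 2 ^ \<nu>" "norm y"] by simp
      then have "norm (conv (dyadic_dilate \<nu> \<phi>) u x) \<le> c * D * ((1 + 4) * (1 + 1)) ^ N * A / (1 + 4 ^ n * norm x) ^ N"
        unfolding dyadic_dilate_eq A_def u_def c_def
        by (intro norm_conv_decay[OF S, where R="4 ^ n"] \<phi> D(2)) (use D in auto)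
      moreover have "2 powr (real \<nu> * \<alpha>) \<le> 2 powr (2 * \<bar>\<alpha>\<bar>) * 2 powr (2 * real n * \<alpha>)"
      proof -
        have "(real \<nu> - 2 * real n) * \<alpha> \<le> 2 * \<bar>\<alpha>\<bar>"
        proof -
          have "\<bar>real \<nu> - 2 * real n\<bar> \<le> 2" using \<nu> by auto
          then have "\<bar>(real \<nu> - 2 * real n) * \<alpha>\<bar> \<le> 2 * \<bar>\<alpha>\<bar>" unfolding abs_mult by (intro mult_right_mono) auto
          then show ?thesis by linarith
        qed
        then have "real \<nu> * \<alpha> \<le> 2 * \<bar>\<alpha>\<bar> + 2 * real n * \<alpha>" by (simp add: algebra_simps)
        then show ?thesis by (simp flip: powr_add)
      qed
      ultimately have "2 powr (real \<nu> * \<alpha>) * norm (conv (dyadic_dilate \<nu> \<phi>) u x) \<le>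
          (2 powr (2 * \<bar>\<alpha>\<bar>) * 2 powr (2 * real n * \<alpha>)) * (c * D * ((1 + 4) * (1 + 1)) ^ N * A / (1 + 4 ^ n * norm x) ^ N)"
        by (intro mult_mono) auto
      then show ?thesis by (simp add: B_def)
    qed
    have "lq_norm q UNIV (\<lambda>\<nu>. ennreal (2 powr (real \<nu> * \<alpha>) * norm (conv (dyadic_dilate \<nu> \<phi>) u x))) \<le>
        ennreal (5 powr enn2real (1 / q) * B / (1 + 4 ^ n * norm x) ^ N)" for x
    proof -
      have "lq_norm q UNIV (\<lambda>\<nu>. ennreal (2 powr (real \<nu> * \<alpha>) * norm (conv (dyadic_dilate \<nu> \<phi>) u x))) \<le>
          ennreal (5 powr enn2real (1 / q) * (B / (1 + 4 ^ n * norm x) ^ N))"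
      proof (rule lq_norm_le_card[OF q, where S="{2 * n - 2..2 * n + 2}"])
        show "real (card {2 * n - 2..2 * n + 2}) \<le> 5" using n by simp
        show "0 \<le> B / (1 + 4 ^ n * norm x) ^ N" using B by (simp add: add_nonneg_nonneg)
      qed (use band zero in \<open>auto intro: ennreal_leI\<close>)
      then show ?thesis by simp
    qed
    then have "Lp_norm p (\<lambda>x. lq_norm q UNIV (\<lambda>\<nu>. ennreal (2 powr (real \<nu> * \<alpha>) * norm (conv (dyadic_dilate \<nu> \<phi>) u x)))) \<le>
        Lp_norm p (\<lambda>x::real^'d. ennreal (5 powr enn2real (1 / q) * B / (1 + 4 ^ n * norm x) ^ N))"
      using p by (intro Lp_norm_mono)
    also have "\<dots> = ennreal (5 powr enn2real (1 / q) * B * (4 ^ n) powr (- real DIM(real^'d) / p) * J)"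
      using B unfolding J_def by (subst Lp_norm_decay[OF p N]) auto
    also have "5 powr enn2real (1 / q) * B * (4 ^ n) powr (- real DIM(real^'d) / p) * J =
        E * J * (2 powr (2 * real n * \<alpha>) * c * (4 ^ n) powr (- real CARD('d) / p))"
      by (simp add: B_def E_def algebra_simps)
    \<comment> \<open>The exponent 2 n (\<alpha> + s - d / p) is zero by the choice of
      \<open>s\<close>, which frees the bound from \<open>n\<close>.\<close>
    also have "2 powr (2 * real n * \<alpha>) * c * (4 ^ n) powr (- real CARD('d) / p) = 1"
      by (simp add: c_def s_def four_power_eq_powr powr_powr flip: powr_add) (simp add: algebra_simps)
    finally have "F_norm \<phi> \<Phi> \<alpha> q p u \<le> ennreal (E * J * 1)"
      by (simp add: F_norm_def 1)
    also have "\<dots> \<le> ennreal (E * J + 1)" by (intro ennreal_leI) simp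
    finally show ?thesis by (simp add: u_def)
  qed
  show ?thesis
  proof (rule that)
    show "0 < E * J + 1" using E by (simp add: J_def add_nonneg_pos)
  qed (use bound in \<open>simp add: s_def\<close>)
qed

text \<open>At the origin this convolution is the integral of |\<phi>|^2. If it vanished, \<phi>
  would be zero almost everywhere and its transform would vanish at \<open>\<xi>\<close>
  too.\<close>

lemma conv_tilde_0_neq_0:
  fixes \<phi> :: "real^'d \<Rightarrow> complex"
  assumes \<phi>: "rapidly_decreasing \<phi>" and nz: "fourier \<phi> \<xi> \<noteq> 0"
  shows "conv \<phi> (distr_of (tilde \<phi>)) 0 \<noteq> 0"
proof
  assume 0: "conv \<phi> (distr_of (tilde \<phi>)) 0 = 0"
  have [measurable]: "\<phi> \<in> borel_measurable borel" using \<phi> by (rule rapidly_decreasing_measurable)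
  obtain B where "\<And>x. norm (\<phi> x) \<le> B" using rapidly_decreasing_bounded[OF \<phi>] by blast
  then have "integrable lborel (\<lambda>x. norm (\<phi> x * \<phi> x))"
    by (intro integrable_norm integrable_mult_bounded[where B=B] integrable_rapidly_decreasing \<phi>) auto
  then have int: "integrable lborel (\<lambda>x. (norm (\<phi> x))\<^sup>2)"
    by (simp add: norm_mult power2_eq_square)
  have "conv \<phi> (distr_of (tilde \<phi>)) 0 = (\<integral>y. of_real ((norm (\<phi> (- y)))\<^sup>2) \<partial>lborel)"
    unfolding conv_distr_of tilde_def
    by (intro Bochner_Integration.integral_cong) (simp_all add: complex_norm_square mult.commute del: of_real_power)
  also have "\<dots> = of_real (\<integral>y. (norm (\<phi> y))\<^sup>2 \<partial>lborel)"
    using volume_scaling_integral[OF volume_scaling_diff[of "0::real^'d"], of "\<lambda>y. (norm (\<phi> y))\<^sup>2"]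
    by (simp del: of_real_power)
  finally have "(\<integral>y. (norm (\<phi> y))\<^sup>2 \<partial>lborel) = 0" using 0 by simp
  then have "AE y in lborel. (norm (\<phi> y))\<^sup>2 = 0"
    using integral_nonneg_eq_0_iff_AE[OF int] by simp
  then have "(\<integral>y. \<phi> y * unit_char (\<xi> \<bullet> y) \<partial>lborel) = 0"
    by (intro integral_eq_zero_AE) auto
  then show False using nz by (simp add: fourier_unit_char)
qed

text \<open>One term of the inner quasi-norm suffices. Up to amplitude, band 2n reproduces a fixed
  continuous function \<open>F\<close> dilated by 4^n; since \<open>F\<close> is nonzero at the
  origin, it stays away from zero on a ball, whose image shrinks like 4^-n. The amplitude and the
  weight compensate for that shrinking.\<close>

lemma F_norm_test_function_ge:
  fixes \<phi> \<Phi> :: "real^'d \<Rightarrow> complex"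
  assumes gen: "dyadic_generators \<phi> \<Phi>" and q: "0 < q" and p: "0 < p"
  obtains c where "0 < c"
    "\<And>n. ennreal c \<le> F_norm \<phi> \<Phi> \<alpha> q p (distr_of (test_function \<phi> (real CARD('d) / p - \<alpha>) n))"
proof -
  define s where "s = real CARD('d) / p - \<alpha>"
  have \<phi>: "rapidly_decreasing \<phi>"
    using gen by (auto simp: dyadic_generators_def intro: rapidly_decreasing_schwartz)
  have [measurable]: "\<phi> \<in> borel_measurable borel" using \<phi> by (rule rapidly_decreasing_measurable)
  \<comment> \<open>A unit vector lies in the shell from 3/5 to 5/3, where
    \<open>fourier \<phi>\<close> is bounded away from zero.\<close>
  obtain \<xi> :: "real^'d" where \<xi>: "norm \<xi> = 1" using vector_choose_size[of 1] by auto
  have "fourier \<phi> \<xi> \<noteq> 0"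
  proof -
    obtain a where "0 < a" "\<And>\<xi>. 3/5 \<le> norm \<xi> \<and> norm \<xi> \<le> 5/3 \<Longrightarrow> a \<le> norm (fourier \<phi> \<xi>)"
      using gen unfolding dyadic_generators_def by blast
    then have "0 < norm (fourier \<phi> \<xi>)" using \<xi> by (smt (verit) divide_le_eq_1 le_divide_eq_1)
    then show ?thesis by simp
  qed
  define F where "F = conv \<phi> (distr_of (tilde \<phi>))"
  have F0: "F 0 \<noteq> 0" unfolding F_def using \<phi> \<open>fourier \<phi> \<xi> \<noteq> 0\<close> by (rule conv_tilde_0_neq_0)
  have "continuous_on UNIV F"
  proof -
    obtain B where "\<And>x. norm (\<phi> x) \<le> B" using rapidly_decreasing_bounded[OF \<phi>] by blast
    then show ?thesis unfolding F_def using \<phi>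
      by (intro continuous_conv[where B=B] integrable_rapidly_decreasing rapidly_decreasing_tilde)
         (auto simp: rapidly_decreasing_def)
  qed
  define m where "m = norm (F 0) / 2"
  have m: "0 < m" using F0 by (simp add: m_def)
  obtain \<rho> where \<rho>: "0 < \<rho>" "\<And>z. dist z 0 < \<rho> \<Longrightarrow> dist (F z) (F 0) < m"
    using \<open>continuous_on UNIV F\<close> m unfolding continuous_on_iff by (metis UNIV_I)
  have Fm: "m \<le> norm (F z)" if "norm z < \<rho>" for z
  proof -
    have "norm (F 0 - F z) < m" using \<rho>(2)[of z] that by (simp add: dist_norm norm_minus_commute)
    then show ?thesis using norm_triangle_ineq2[of "F 0" "F z"] by (simp add: m_def)
  qed
  define V where "V = measure lborel (ball (0::real^'d) 1) powr (1 / p)"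
  have V: "0 < V" unfolding V_def by (simp add: content_ball_pos)
  define c where "c = m * \<rho> powr (real CARD('d) / p) * V"
  have bound: "ennreal c \<le> F_norm \<phi> \<Phi> \<alpha> q p (distr_of (test_function \<phi> s n))" for n
  proof -
    define u where "u = distr_of (test_function \<phi> s n)"
    define R :: real where "R = 4 ^ n"
    define w where "w = 2 powr (2 * real n * \<alpha>) * 2 powr (2 * real n * s)"
    have R: "0 < R" by (simp add: R_def)
    have S: "volume_scaling (\<lambda>y::real^'d. R *\<^sub>R y) (R ^ DIM(real^'d))" using R by (rule volume_scaling_scaleR)
    \<comment> \<open>At \<nu> = 2 n the dilation factor is exactly \<open>R\<close>, so the kernel
      and the test function are dilated alike and the substitution by \<open>R\<close> reduces the
      integral to \<open>F\<close>.\<close>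
    have conv: "conv (dyadic_dilate (2 * n) \<phi>) u x = of_real (2 powr (2 * real n * s)) * F (R *\<^sub>R x)" for x
    proof -
      have R2: "2 ^ (2 * n) = R" by (simp add: R_def power_mult)
      have meas: "(\<lambda>z. tilde \<phi> z * \<phi> (R *\<^sub>R x - z)) \<in> borel_measurable borel"
        unfolding tilde_def by measurable
      have "conv (dyadic_dilate (2 * n) \<phi>) u x =
          (\<integral>y. of_real (2 powr (2 * real n * s)) * (of_real (R ^ DIM(real^'d)) *
            (tilde \<phi> (R *\<^sub>R y) * \<phi> (R *\<^sub>R x - R *\<^sub>R y))) \<partial>lborel)"
        unfolding u_def conv_distr_of dyadic_dilate_eq R2
        by (intro Bochner_Integration.integral_cong)
           (simp_all add: test_function_def R_def scaleR_diff_right algebra_simps)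
      also have "\<dots> = of_real (2 powr (2 * real n * s)) * F (R *\<^sub>R x)"
        unfolding F_def conv_distr_of volume_scaling_integral[OF S meas]
        by (simp add: scaleR_conv_of_real)
      finally show ?thesis .
    qed
    have "ennreal (w * m * indicator (ball 0 (\<rho> / R)) x) \<le>
        lq_norm q UNIV (\<lambda>\<nu>. ennreal (2 powr (real \<nu> * \<alpha>) * norm (conv (dyadic_dilate \<nu> \<phi>) u x)))" for x
    proof -
      have "w * m * indicator (ball 0 (\<rho> / R)) x \<le> w * norm (F (R *\<^sub>R x))"
      proof (cases "norm x < \<rho> / R")
        case True
        then have "norm (R *\<^sub>R x) < \<rho>" using R by (simp add: field_simps)
        then show ?thesis using Fm by (auto simp: w_def indicator_def)
      qed (simp add: indicator_def w_def)
      also have "\<dots> = 2 powr (real (2 * n) * \<alpha>) * norm (conv (dyadic_dilate (2 * n) \<phi>) u x)"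
        by (simp add: conv norm_mult w_def)
      finally have "ennreal (w * m * indicator (ball 0 (\<rho> / R)) x) \<le> 
          ennreal (2 powr (real (2 * n) * \<alpha>) * norm (conv (dyadic_dilate (2 * n) \<phi>) u x))"
        by (rule ennreal_leI)
      also have "\<dots> \<le> lq_norm q UNIV (\<lambda>\<nu>. ennreal (2 powr (real \<nu> * \<alpha>) * norm (conv (dyadic_dilate \<nu> \<phi>) u x)))"
        by (rule lq_norm_ge[OF q UNIV_I])
      finally show ?thesis .
    qed
    then have "Lp_norm p (\<lambda>x::real^'d. ennreal (w * m * indicator (ball 0 (\<rho> / R)) x)) \<le>
        Lp_norm p (\<lambda>x. lq_norm q UNIV (\<lambda>\<nu>. ennreal (2 powr (real \<nu> * \<alpha>) * norm (conv (dyadic_dilate \<nu> \<phi>) u x))))"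
      using p by (intro Lp_norm_mono)
    also have "\<dots> \<le> F_norm \<phi> \<Phi> \<alpha> q p u" by (simp add: F_norm_def)
    also have "Lp_norm p (\<lambda>x::real^'d. ennreal (w * m * indicator (ball 0 (\<rho> / R)) x)) =
        ennreal (w * m * (\<rho> / R) powr (real DIM(real^'d) / p) * V)"
      unfolding V_def using p \<rho>(1) R m by (intro Lp_norm_indicator_ball) (auto simp: w_def)
    also have "w * m * (\<rho> / R) powr (real DIM(real^'d) / p) * V = c * (w * R powr (- real CARD('d) / p))"
      using \<rho>(1) R by (simp add: c_def powr_divide powr_minus field_simps)
    also have "w * R powr (- real CARD('d) / p) = 1"
      by (simp add: w_def s_def R_def four_power_eq_powr powr_powr flip: powr_add) (simp add: algebra_simps)
    finally show ?thesis by (simp add: u_def)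
  qed
  show ?thesis
  proof (rule that)
    show "0 < c" using m \<rho>(1) V by (simp add: c_def)
  qed (use bound in \<open>simp add: s_def\<close>)
qed

section \<open>Upper bound for the shear anisotropic norm\<close>

lemma FAB_norm_test_function_le:
  fixes \<phi> \<Phi> \<Psi> :: "real^'d \<Rightarrow> complex" and \<psi> :: "'d \<Rightarrow> real^'d \<Rightarrow> complex"
  assumes dgen: "dyadic_generators \<phi> \<Phi>" and sgen: "shearlet_generators \<psi>1h \<psi>2h \<psi> \<Psi>"
    and q: "0 < q" and p: "0 < p"
  obtains C where "0 \<le> C"
    "\<And>n. CARD('d) \<le> n \<Longrightarrow> FAB_norm \<psi> \<Psi> \<alpha> q p (distr_of (test_function \<phi> s n)) \<le>
       ennreal (C * 2 powr (real n * ((real CARD('d) - 1) * enn2real (1 / q) +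
         (real CARD('d) + 1) * \<alpha> + 2 * s - real CARD('d) / p)))"
proof -
  define d where "d = CARD('d)"
  have d1: "1 \<le> d" by (simp add: d_def Suc_leI)
  have \<phi>: "rapidly_decreasing \<phi>"
    using dgen by (auto simp: dyadic_generators_def intro: rapidly_decreasing_schwartz)
  have supp: "supp (fourier \<phi>) \<subseteq> {\<xi>. 1/2 \<le> norm \<xi> \<and> norm \<xi> \<le> 2}"
    using dgen by (auto simp: dyadic_generators_def)
  have \<psi>: "rapidly_decreasing (\<psi> \<dd>)" and ft: "fourier (\<psi> \<dd>) = psi_hat \<psi>1h \<psi>2h \<dd>" for \<dd>
    using sgen by (auto simp: shearlet_generators_def intro: rapidly_decreasing_schwartz)
  have \<Psi>: "rapidly_decreasing \<Psi>"
    using sgen by (auto simp: shearlet_generators_def intro: rapidly_decreasing_schwartz)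
  have \<psi>1: "supp \<psi>1h \<subseteq> {-1/2..-1/16} \<union> {1/16..1/2}" and \<psi>2: "supp \<psi>2h \<subseteq> {-1..1}"
    and supp': "supp (fourier \<Psi>) \<subseteq> {\<xi>. \<forall>i. \<bar>\<xi> $ i\<bar> \<le> 1/4}"
    using sgen by (auto simp: shearlet_generators_def)
  obtain N :: nat where "2 * real DIM(real^'d) / p \<le> real N" using real_arch_simple by blast
  then have N: "2 * real DIM(real^'d) \<le> real N * p" using p by (simp add: field_simps)
  obtain D where D: "0 \<le> D"
    "\<And>s n y. norm (test_function \<phi> s n y) \<le> (2 powr (2 * real n * s) * D) / (1 + 4 ^ n * norm y) ^ N"
    using test_function_decay[OF \<phi>] by metis
  define A0 where "A0 \<dd> = (\<integral>z. norm (tilde (\<psi> \<dd>) z) * (1 + norm z) ^ N \<partial>lborel)" for \<dd>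
  have A0: "0 \<le> A0 \<dd>" for \<dd> by (simp add: A0_def)
  \<comment> \<open>Summing over the finitely many cone directions makes the moment bound uniform in
    \<open>\<dd>\<close>.\<close>
  define A where "A = (\<Sum>\<dd>\<in>UNIV. A0 \<dd>)"
  have A: "A0 \<dd> \<le> A" for \<dd> unfolding A_def by (intro member_le_sum A0) auto
  have A_nonneg: "0 \<le> A" unfolding A_def by (intro sum_nonneg A0)
  define J where "J = (\<integral>x. (1 + norm (x::real^'d)) powr (- (real N * p)) \<partial>lborel) powr (1 / p)"
  \<comment> \<open>The factor 2^d compensates for scales \<open>j\<close> as low as n - d; d^2 is
    the constant of \<open>norm_le_AB_mat\<close>.\<close>
  define K where "K = 2 ^ d * (real d)\<^sup>2"
  have K: "0 \<le> K" by (simp add: K_def)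
  define t where "t = enn2real (1 / q)"
  \<comment> \<open>There are \<open>d\<close> directions, \<open>d + 3\<close> scales from n - d to
    n + 2, and at most 2 * 2^(n+2) + 1 \<le> 9 * 2^n values for each of the d - 1 shear
    entries.\<close>
  define M where "M = real d * (real d + 3) * 9 ^ (d - 1)"
  have M: "1 \<le> M"
  proof -
    have "1 * 1 * 1 \<le> real d * (real d + 3) * 9 ^ (d - 1)" using d1 by (intro mult_mono) auto
    then show ?thesis by (simp add: M_def)
  qed
  \<comment> \<open>Retained scales satisfy |j - n| \<le> d + 2, so replacing \<open>j\<close> by
    \<open>n\<close> in the weight \<open>Q_vol\<close> costs at most this factor, whatever the sign
    of \<alpha>.\<close>
  define L where "L = 2 powr ((real d + 1) * (real d + 2) * \<bar>\<alpha>\<bar>)"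
  define E where "E = M powr t * (L * (D * ((1 + K) * (1 + 1)) ^ N * A))"
  have E: "0 \<le> E" using D A_nonneg K by (simp add: E_def L_def)
  have bound: "FAB_norm \<psi> \<Psi> \<alpha> q p (distr_of (test_function \<phi> s n)) \<le>
      ennreal (E * J * 2 powr (real n * ((real d - 1) * t + (real d + 1) * \<alpha> + 2 * s - real d / p)))"
    if n: "d \<le> n" for n
  proof -
    define c where "c = 2 powr (2 * real n * s)"
    define u where "u = distr_of (test_function \<phi> s n)"
    \<comment> \<open>This elementary inequality trades the dimension factor in the support radii
      for at most \<open>d\<close> scales.\<close>
    have d4: "real d < 4 ^ d"
    proof -
      have "d < 4 ^ d" by (induction d) auto
      then show ?thesis by (metis of_nat_less_iff of_nat_numeral of_nat_power)
    qed
    have dn: "(4::real) ^ d \<le> 4 ^ n" using n by (intro power_increasing) auto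
    have "fourier \<Psi> \<xi> = 0" if \<xi>: "4 ^ n / 2 \<le> norm \<xi>" for \<xi>
    proof (rule ccontr)
      assume "fourier \<Psi> \<xi> \<noteq> 0"
      then have "\<bar>\<xi> $ i\<bar> \<le> 1 / 4" for i using supp_memI[of "fourier \<Psi>" \<xi>] supp' by blast
      then have "norm \<xi> \<le> (\<Sum>i\<in>(UNIV::'d set). 1 / 4)" by (intro order_trans[OF norm_le_l1_cart] sum_mono)
      then have "norm \<xi> \<le> real d / 4" by (simp add: d_def)
      then show False using \<xi> d4 dn by linarith
    qed
    then have "conv \<Psi> u x = 0" for x
      unfolding u_def by (intro conv_test_function_eq_0 \<phi> \<Psi> supp)
    then have 1: "Lp_norm p (\<lambda>x. ennreal (norm (conv \<Psi> u x))) = 0"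
      using p by (simp add: Lp_norm_eq_0)
    define T where "T \<dd> j l x = Q_vol TYPE('d) j powr (- \<alpha>) *
        norm (conv (mat_dilate (AB_mat \<dd> j l) (tilde (\<psi> \<dd>))) u x)" for \<dd> j l x
    define S :: "('d \<times> nat \<times> ('d \<Rightarrow> int)) set" where "S = shear_band (n - d) (n + 2)"
    have shear_le: "2 ^ j * norm y \<le> (real d)\<^sup>2 * norm (matrix_inv (AB_mat \<dd> j l) *v y)"
      if "l \<in> shears \<dd> j" for \<dd> j l and y :: "real^'d"
      using norm_le_AB_mat[OF that] by (simp add: d_def)
    \<comment> \<open>Overlap of the shells forces 4^j / 16 \<le> 2 * 4^n, hence j \<le> n + 2, and
      4^n / 2 \<le> d 4^j, hence 4^n < 4^(d + j + 1) and n - d \<le> j.\<close>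
    have zero: "T \<dd> j l x = 0" if l: "l \<in> shears \<dd> j" and j: "\<not> (n - d \<le> j \<and> j \<le> n + 2)" for \<dd> j l x
    proof -
      have rd: "rapidly_decreasing (mat_dilate (AB_mat \<dd> j l) (tilde (\<psi> \<dd>)))"
        unfolding mat_dilate_def[abs_def]
      proof (rule rapidly_decreasing_linear_image[where g="tilde (\<psi> \<dd>)" and K="(real d)\<^sup>2 / 2 ^ j"])
        show "rapidly_decreasing (tilde (\<psi> \<dd>))" by (intro rapidly_decreasing_tilde \<psi>)
        show "norm x \<le> ((real d)\<^sup>2 / 2 ^ j) * norm (matrix_inv (AB_mat \<dd> j l) *v x)" for x
          using shear_le[OF l, of x] by (simp add: field_simps)
      qed (rule matrix_vector_mul_linear)
      have "fourier (mat_dilate (AB_mat \<dd> j l) (tilde (\<psi> \<dd>))) \<xi> = 0"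
        if \<xi>: "4 ^ n / 2 \<le> norm \<xi>" "norm \<xi> \<le> 2 * 4 ^ n" for \<xi>
      proof (rule ccontr)
        assume "fourier (mat_dilate (AB_mat \<dd> j l) (tilde (\<psi> \<dd>))) \<xi> \<noteq> 0"
        note * = fourier_shearlet_support[OF rapidly_decreasing_measurable[OF \<psi>] ft \<psi>1 \<psi>2 l this]
        have "(0::real) < 4 ^ n" by simp
        then have "(4::real) ^ j < 64 * 4 ^ n" using *(1) \<xi>(2) by linarith
        then have "(4::real) ^ j < 4 ^ (n + 3)" by (simp add: power_add)
        then have "j < n + 3" by (rule power_less_imp_less_exp[rotated]) simp
        moreover have "(4::real) ^ n < 4 ^ (d + j + 1)"
        proof -
          have "4 ^ n \<le> 2 * (real d * 4 ^ j)" using *(2) \<xi>(1) by (simp add: d_def)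
          also have "\<dots> \<le> 2 * (4 ^ d * 4 ^ j)" using d4 by (intro mult_left_mono mult_right_mono) auto
          also have "\<dots> < 4 ^ (d + j + 1)" by (simp add: power_add)
          finally show ?thesis .
        qed
        then have "n < d + j + 1" by (rule power_less_imp_less_exp[rotated]) simp
        ultimately show False using j by auto
      qed
      then have "conv (mat_dilate (AB_mat \<dd> j l) (tilde (\<psi> \<dd>))) u x = 0"
        unfolding u_def by (intro conv_test_function_eq_0 \<phi> supp rd)
      then show ?thesis by (simp add: T_def)
    qed
    define B where "B = L * 2 powr (real n * ((real d + 1) * \<alpha>)) * (c * D * ((1 + K) * (1 + 1)) ^ N * A)"
    have B: "0 \<le> B" using D A_nonneg K by (simp add: B_def c_def L_def)
    have band: "T \<dd> j l x \<le> B / (1 + 2 ^ n * norm x) ^ N"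
      if l: "l \<in> shears \<dd> j" and j: "n - d \<le> j" "j \<le> n + 2" for \<dd> j l x
    proof -
      have le: "2 ^ n * norm y \<le> K * norm (matrix_inv (AB_mat \<dd> j l) *v y)" for y :: "real^'d"
      proof -
        have "(2::real) ^ n \<le> 2 ^ (d + j)" using j by (intro power_increasing) auto
        then have "2 ^ n * norm y \<le> 2 ^ d * (2 ^ j * norm y)"
          using mult_right_mono[of "2 ^ n" "2 ^ (d + j)" "norm y"] by (simp add: power_add mult.assoc)
        also have "\<dots> \<le> 2 ^ d * ((real d)\<^sup>2 * norm (matrix_inv (AB_mat \<dd> j l) *v y))"
          by (intro mult_left_mono shear_le l) simp
        finally show ?thesis by (simp add: K_def)
      qed
      \<comment> \<open>The test function has scale 4^-n, but a shearlet may extend over 2^-n; the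
        coarser scale governs, so the decay estimate is taken with r = 2^n and R = 4^n.\<close>
      have "norm (conv (mat_dilate (AB_mat \<dd> j l) (tilde (\<psi> \<dd>))) u x) \<le>
          c * D * ((1 + K) * (1 + 1)) ^ N * A0 \<dd> / (1 + 2 ^ n * norm x) ^ N"
        unfolding mat_dilate_def[abs_def] A0_def u_def c_def
        by (intro norm_conv_decay[OF volume_scaling_AB_mat le, where R="4 ^ n"] rapidly_decreasing_tilde \<psi> D(2))
           (use D K in \<open>auto intro: power_mono\<close>)
      also have "\<dots> \<le> c * D * ((1 + K) * (1 + 1)) ^ N * A / (1 + 2 ^ n * norm x) ^ N"
        using D K by (intro divide_right_mono mult_left_mono A) (auto simp: c_def)
      finally have conv: "norm (conv (mat_dilate (AB_mat \<dd> j l) (tilde (\<psi> \<dd>))) u x) \<le>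
          c * D * ((1 + K) * (1 + 1)) ^ N * A / (1 + 2 ^ n * norm x) ^ N" .
      have "Q_vol TYPE('d) j powr (- \<alpha>) \<le> L * 2 powr (real n * ((real d + 1) * \<alpha>))"
      proof -
        have "\<bar>real j - real n\<bar> \<le> real d + 2" using j by linarith
        then have "\<bar>(real j - real n) * \<alpha>\<bar> \<le> (real d + 2) * \<bar>\<alpha>\<bar>"
          unfolding abs_mult by (intro mult_right_mono) auto
        then have "(real j - real n) * \<alpha> \<le> (real d + 2) * \<bar>\<alpha>\<bar>" by linarith
        then have "(real d + 1) * ((real j - real n) * \<alpha>) \<le> (real d + 1) * ((real d + 2) * \<bar>\<alpha>\<bar>)"
          by (intro mult_left_mono) auto
        then have "(real d + 1) * real j * \<alpha> \<le> (real d + 1) * (real d + 2) * \<bar>\<alpha>\<bar> + real n * ((real d + 1) * \<alpha>)"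
          by (simp add: algebra_simps)
        then show ?thesis by (simp add: Q_vol_def L_def powr_powr d_def add.commute flip: powr_add)
      qed
      then have "T \<dd> j l x \<le> (L * 2 powr (real n * ((real d + 1) * \<alpha>))) *
          (c * D * ((1 + K) * (1 + 1)) ^ N * A / (1 + 2 ^ n * norm x) ^ N)"
        unfolding T_def using conv by (intro mult_mono) (auto simp: L_def)
      then show ?thesis by (simp add: B_def)
    qed
    define m where "m = M * 2 powr (real n * (real d - 1))"
    have m: "1 \<le> m"
    proof -
      have "1 * 1 \<le> M * 2 powr (real n * (real d - 1))" using M d1 by (intro mult_mono ge_one_powr_ge_zero) auto
      then show ?thesis by (simp add: m_def)
    qed
    have card: "real (card S) \<le> m"
    proof -
      have "card S \<le> d * (Suc (n + 2) - (n - d)) * (2 * 2 ^ (n + 2) + 1) ^ (d - 1)"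
        unfolding S_def d_def by (rule card_shear_band_le)
      also have "Suc (n + 2) - (n - d) = d + 3" using n by simp
      also have "(2 * 2 ^ (n + 2) + 1 :: nat) ^ (d - 1) \<le> (9 * 2 ^ n) ^ (d - 1)"
        by (intro power_mono) (auto simp: power_add)
      finally have "card S \<le> d * (d + 3) * (9 * 2 ^ n) ^ (d - 1)" by simp
      then have "real (card S) \<le> real (d * (d + 3) * (9 * 2 ^ n) ^ (d - 1))" by (simp only: of_nat_le_iff)
      also have "\<dots> = M * (2 ^ n) ^ (d - 1)" by (simp add: M_def power_mult_distrib)
      also have "(2 ^ n :: real) ^ (d - 1) = 2 powr (real n * (real d - 1))"
        using d1 by (simp add: powr_realpow[symmetric] powr_powr of_nat_diff flip: power_mult)
      finally show ?thesis by (simp add: m_def)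
    qed
    have "lq_norm q shear_index (\<lambda>(\<dd>, j, l). ennreal (T \<dd> j l x)) \<le>
        ennreal (m powr t * B / (1 + 2 ^ n * norm x) ^ N)" for x
    proof -
      have "lq_norm q shear_index (\<lambda>(\<dd>, j, l). ennreal (T \<dd> j l x)) \<le>
          ennreal (m powr enn2real (1 / q) * (B / (1 + 2 ^ n * norm x) ^ N))"
      \<comment> \<open>No orthogonality between different shears is exploited: each retained index
        is charged with the same bound, and their number yields the factor
        \<open>m powr t\<close>.\<close>
      proof (rule lq_norm_le_card[OF q _ card m])
        show "finite S" unfolding S_def by (rule finite_shear_band)
        show "0 \<le> B / (1 + 2 ^ n * norm x) ^ N" using B by (simp add: add_nonneg_nonneg)
        fix i :: "'d \<times> nat \<times> ('d \<Rightarrow> int)" assume i: "i \<in> shear_index"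
        obtain \<dd> j l where [simp]: "i = (\<dd>, j, l)" by (cases i)
        have l: "l \<in> shears \<dd> j" using i by (simp add: shear_index_def)
        show "(case i of (\<dd>, j, l) \<Rightarrow> ennreal (T \<dd> j l x)) \<le> ennreal (B / (1 + 2 ^ n * norm x) ^ N)" if "i \<in> S"
          using that band[OF l] by (auto simp: S_def shear_band_def intro: ennreal_leI)
        show "(case i of (\<dd>, j, l) \<Rightarrow> ennreal (T \<dd> j l x)) = 0" if "i \<notin> S"
          using that zero[OF l] l by (auto simp: S_def shear_band_def)
      qed
      then show ?thesis by (simp add: t_def)
    qed
    then have "Lp_norm p (\<lambda>x. lq_norm q shear_index (\<lambda>(\<dd>, j, l). ennreal (T \<dd> j l x))) \<le>
        Lp_norm p (\<lambda>x::real^'d. ennreal (m powr t * B / (1 + 2 ^ n * norm x) ^ N))"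
      using p by (intro Lp_norm_mono)
    also have "\<dots> = ennreal (m powr t * B * (2 ^ n) powr (- real DIM(real^'d) / p) * J)"
      using B unfolding J_def by (subst Lp_norm_decay[OF p N]) auto
    also have "m powr t * B * (2 ^ n) powr (- real DIM(real^'d) / p) * J =
        E * J * (2 powr (real n * (real d - 1) * t) * 2 powr (real n * ((real d + 1) * \<alpha>)) * c *
          2 powr (real n * (- real d / p)))"
      using M by (simp add: m_def B_def E_def powr_mult powr_powr d_def powr_realpow[symmetric] algebra_simps)
    \<comment> \<open>The four powers are, in order, the count of shears, the weight at scale
      \<open>n\<close>, the amplitude, and the L^p size of a bump of width 2^-n.\<close>
    also have "2 powr (real n * (real d - 1) * t) * 2 powr (real n * ((real d + 1) * \<alpha>)) * c *
          2 powr (real n * (- real d / p)) =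
        2 powr (real n * ((real d - 1) * t + (real d + 1) * \<alpha> + 2 * s - real d / p))"
      by (simp add: c_def algebra_simps flip: powr_add)
    finally show ?thesis
      unfolding FAB_norm_def u_def[symmetric] 1 by (simp add: T_def)
  qed
  show ?thesis
  proof (rule that)
    show "0 \<le> E * J" using E by (simp add: J_def)
  qed (use bound in \<open>simp add: d_def t_def\<close>)
qed

section \<open>Choice of the sequence and passage to the limit\<close>

theorem theorem7p9:
  fixes \<phi> \<Phi> \<Psi> :: "real^'d \<Rightarrow> complex"
    and \<psi> :: "'d \<Rightarrow> real^'d \<Rightarrow> complex"
    and \<psi>1h \<psi>2h :: "real \<Rightarrow> complex"
    and \<alpha>1 \<alpha>2 p1 p2 :: real
    and q1 q2 :: ennreal
  assumes "CARD('d) \<ge> 2"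
    and "dyadic_generators \<phi> \<Phi>"
    and "shearlet_generators \<psi>1h \<psi>2h \<psi> \<Psi>"
    and "0 < q1" and "0 < q2" and "0 < p1" and "0 < p2"
    and "(real CARD('d) - 1) * enn2real (1 / q2) + (real CARD('d) + 1) * \<alpha>2 + 2 * real CARD('d) / p1
           < 2 * \<alpha>1 + real CARD('d) / p2"
  shows "\<exists>f :: nat \<Rightarrow> real^'d \<Rightarrow> complex.
           (\<forall>\<nu>. tempered_function (f \<nu>) \<and>
                distr_of (f \<nu>) \<in> F_space \<phi> \<Phi> \<alpha>1 q1 p1 \<and>
                distr_of (f \<nu>) \<in> FAB_space \<psi> \<Psi> \<alpha>2 q2 p2) \<and>
           (\<exists>c C. 0 < c \<and> 0 < C \<and>
              (\<forall>\<nu>. ennreal c \<le> F_norm \<phi> \<Phi> \<alpha>1 q1 p1 (distr_of (f \<nu>)) \<and>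
                   F_norm \<phi> \<Phi> \<alpha>1 q1 p1 (distr_of (f \<nu>)) \<le> ennreal C)) \<and>
           (\<lambda>\<nu>. FAB_norm \<psi> \<Psi> \<alpha>2 q2 p2 (distr_of (f \<nu>))) \<longlonglongrightarrow> 0"
proof -
  define d where "d = CARD('d)"
  have d: "2 \<le> d" using assms(1) by (simp add: d_def)
  define s where "s = real CARD('d) / p1 - \<alpha>1"
  \<comment> \<open>Starting at index \<open>d\<close>, which is at least 2, meets both thresholds,
    2 \<le> n for the classical bound and d \<le> n for the shearlet bound, at every \<nu>.\<close>
  define f where "f = (\<lambda>\<nu>. test_function \<phi> s (\<nu> + d))"
  define \<epsilon> where "\<epsilon> = (real CARD('d) - 1) * enn2real (1 / q2) + (real CARD('d) + 1) * \<alpha>2 + 2 * s - real CARD('d) / p2"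
  \<comment> \<open>Inserting \<open>s\<close> turns the term \<open>2 * s\<close> into 2 d / p1 - 2
    \<alpha>1, so this is the hypothesis rearranged.\<close>
  have \<epsilon>: "\<epsilon> < 0" using assms(8) by (simp add: \<epsilon>_def s_def algebra_simps)
  have "rapidly_decreasing \<phi>"
    using assms(2) by (auto simp: dyadic_generators_def intro: rapidly_decreasing_schwartz)
  then have f: "tempered_function (f \<nu>)" for \<nu>
    unfolding f_def by (intro tempered_function_rapidly_decreasing rapidly_decreasing_test_function)
  obtain C where C: "0 < C" "\<And>\<nu>. F_norm \<phi> \<Phi> \<alpha>1 q1 p1 (distr_of (f \<nu>)) \<le> ennreal C"
    using F_norm_test_function_le[OF assms(2,4,6), of \<alpha>1] d unfolding f_def s_def
    by (metis le_add2 order_trans)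
  obtain c where c: "0 < c" "\<And>\<nu>. ennreal c \<le> F_norm \<phi> \<Phi> \<alpha>1 q1 p1 (distr_of (f \<nu>))"
    using F_norm_test_function_ge[OF assms(2,4,6), of \<alpha>1] unfolding f_def s_def by metis
  obtain G where G: "0 \<le> G"
    "\<And>n. CARD('d) \<le> n \<Longrightarrow> FAB_norm \<psi> \<Psi> \<alpha>2 q2 p2 (distr_of (test_function \<phi> s n)) \<le> ennreal (G * 2 powr (real n * \<epsilon>))"
    using FAB_norm_test_function_le[OF assms(2,3,5,7), of \<alpha>2 s] unfolding \<epsilon>_def by metis
  have FAB: "FAB_norm \<psi> \<Psi> \<alpha>2 q2 p2 (distr_of (f \<nu>)) \<le> ennreal (G * 2 powr (real (\<nu> + d) * \<epsilon>))" for \<nu>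
    unfolding f_def using G(2)[of "\<nu> + d"] by (simp add: d_def)
  have "(\<lambda>\<nu>. G * 2 powr (real (\<nu> + d) * \<epsilon>)) \<longlonglongrightarrow> G * 0"
  proof (intro tendsto_mult_left)
    have "(\<lambda>\<nu>. (2 powr \<epsilon>) ^ (\<nu> + d)) \<longlonglongrightarrow> 0"
      using \<epsilon> by (intro LIMSEQ_ignore_initial_segment LIMSEQ_power_zero) (simp add: powr_less_one)
    then show "(\<lambda>\<nu>. 2 powr (real (\<nu> + d) * \<epsilon>)) \<longlonglongrightarrow> 0"
      by (simp add: powr_realpow[symmetric] powr_powr mult.commute)
  qed
  then have "(\<lambda>\<nu>. ennreal (G * 2 powr (real (\<nu> + d) * \<epsilon>))) \<longlonglongrightarrow> 0"
    using tendsto_ennrealI by fastforce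
  then have lim: "(\<lambda>\<nu>. FAB_norm \<psi> \<Psi> \<alpha>2 q2 p2 (distr_of (f \<nu>))) \<longlonglongrightarrow> 0"
    by (rule tendsto_sandwich[rotated 3, OF _ _ _ tendsto_const]) (use FAB in auto)
  \<comment> \<open>The explicit upper bounds are finite for each \<nu>, so they also settle
    membership in the two spaces.\<close>
  have "distr_of (f \<nu>) \<in> F_space \<phi> \<Phi> \<alpha>1 q1 p1" "distr_of (f \<nu>) \<in> FAB_space \<psi> \<Psi> \<alpha>2 q2 p2" for \<nu>
    using f[of \<nu>] C(2)[of \<nu>] FAB[of \<nu>]
    by (auto simp: F_space_def FAB_space_def tempered_function_def intro: le_less_trans)
  then show ?thesis using f C c lim by blast
qed

end
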